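(* For every $k\in\mathbb N$, the following subsets of the space $\mathcal G_k$ of marked $k$-generated groups are $G_\delta$ sets: (a) the set of all topologizable groups; (b) the set of all Tarski Monsters of any fixed finite exponent.
   Context: Let $F_k$ be the free group with basis $X=\{x_1,\ldots,x_k\}$ and let $\mathcal G_k$ be the set of all normal subgroups of $F_k$, with the (ultra)metric $\mathrm d(M,N)=\max\{1/|w| : w\in M\vartriangle N\}$ if $M\neq N$ and $\mathrm d(M,M)=0$, where $|\cdot|$ is word length with respect to $X$. One identifies $\mathcal G_k$ with the set of marked $k$-generated groups, i.e. pairs $(G,(x_1,\ldots,x_k))$ where $G$ is a group and $(x_1,\ldots,x_k)$ is a generating $k$-tuple of $G$ ($N\lhd F_k$ corresponds to $F_k/N$ with the images of the basis elements). "The set of all groups with a property" means the set of elements of $\mathcal G_k$ whose underlying group has that property. A subset of a topological space is a $G_\delta$ set if it is an intersection of countably many open sets. A group is topologizable if it admits a non-discrete Hausdorff group topology. A Tarski Monster is a finitely generated infinite simple group all of whose proper subgroups are finite cyclic. A group $G$ is of finite exponent $n$, for a positive integer $n$, if $g^n=1$ for every $g\in G$. *)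

theory Defs
  imports
    "HOL-Algebra.Elementary_Groups"
    "HOL-Algebra.Generated_Groups"
    "HOL-Analysis.Abstract_Metric_Spaces"
    "HOL-Analysis.FSigma"
begin

section \<open>Free groups\<close>

text \<open>The letter \<open>(False, x)\<close> stands for the basis element \<open>x\<close>, and \<open>(True, x)\<close> for its inverse.
  Elements of the free group are the freely reduced words, so that the word length
  of an element with respect to the basis is the length of the list.\<close>

type_synonym 'a word = "(bool \<times> 'a) list"

definition letter_inv :: "bool \<times> 'a \<Rightarrow> bool \<times> 'a" where
  "letter_inv a = (\<not> fst a, snd a)"

definition reduced :: "'a word \<Rightarrow> bool" where
  "reduced = successively (\<lambda>a b. b \<noteq> letter_inv a)"

fun cons_reduce :: "bool \<times> 'a \<Rightarrow> 'a word \<Rightarrow> 'a word" where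
  "cons_reduce a [] = [a]"
| "cons_reduce a (b # w) = (if b = letter_inv a then w else a # b # w)"

text \<open>On reduced words, \<open>word_mult\<close> is concatenation followed by free reduction.\<close>

definition word_mult :: "'a word \<Rightarrow> 'a word \<Rightarrow> 'a word" where
  "word_mult u v = foldr cons_reduce u v"

definition free_group :: "'a set \<Rightarrow> 'a word monoid" where
  "free_group X =
     \<lparr>carrier = {w. reduced w \<and> snd ` set w \<subseteq> X}, mult = word_mult, one = []\<rparr>"

lemma letter_inv_letter_inv [simp]: "letter_inv (letter_inv a) = a"
  by (simp add: letter_inv_def)

lemma snd_letter_inv [simp]: "snd (letter_inv a) = snd a"
  by (simp add: letter_inv_def)

lemma letter_inv_neq [simp]: "letter_inv a \<noteq> a" "a \<noteq> letter_inv a"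
  by (cases a; simp add: letter_inv_def)+

lemma letter_inv_inject [simp]: "letter_inv a = letter_inv b \<longleftrightarrow> a = b"
  by (metis letter_inv_letter_inv)

lemma reduced_Nil [simp]: "reduced []"
  by (simp add: reduced_def)

lemma reduced_single [simp]: "reduced [a]"
  by (simp add: reduced_def)

lemma reduced_Cons_Cons [simp]:
  "reduced (a # b # w) \<longleftrightarrow> b \<noteq> letter_inv a \<and> reduced (b # w)"
  by (auto simp: reduced_def)

lemma reduced_ConsD: "reduced (a # w) \<Longrightarrow> reduced w"
  by (cases w) auto

lemma cons_reduce_reduced: "reduced w \<Longrightarrow> reduced (cons_reduce a w)"
  by (cases w) (auto dest: reduced_ConsD)

lemma cons_reduce_Cons: "reduced (a # w) \<Longrightarrow> cons_reduce a w = a # w"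
  by (cases w) auto

lemma cons_reduce_cancel: "reduced w \<Longrightarrow> cons_reduce (letter_inv a) (cons_reduce a w) = w"
  by (cases w) (auto simp: cons_reduce_Cons)

lemma cons_reduce_cancel': "reduced w \<Longrightarrow> cons_reduce a (cons_reduce (letter_inv a) w) = w"
  using cons_reduce_cancel[of w "letter_inv a"] by simp

lemma snd_set_cons_reduce: "snd ` set (cons_reduce a w) \<subseteq> insert (snd a) (snd ` set w)"
  by (cases w) auto

lemma word_mult_Nil [simp]: "word_mult [] w = w"
  by (simp add: word_mult_def)

lemma word_mult_Cons [simp]: "word_mult (a # u) w = cons_reduce a (word_mult u w)"
  by (simp add: word_mult_def)

lemma word_mult_append: "word_mult (u @ v) w = word_mult u (word_mult v w)"
  by (simp add: word_mult_def)

lemma word_mult_reduced: "reduced w \<Longrightarrow> reduced (word_mult u w)"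
  by (induction u) (auto intro: cons_reduce_reduced)

lemma snd_set_word_mult: "snd ` set (word_mult u w) \<subseteq> snd ` set u \<union> snd ` set w"
proof (induction u)
  case (Cons a u)
  then show ?case
    using snd_set_cons_reduce[of a "word_mult u w"] by simp blast
qed simp

lemma word_mult_Nil_right: "reduced w \<Longrightarrow> word_mult w [] = w"
  by (induction w) (simp_all, metis cons_reduce_Cons reduced_ConsD)

lemma word_mult_cons_reduce:
  "reduced w \<Longrightarrow> word_mult (cons_reduce a v) w = cons_reduce a (word_mult v w)"
  by (cases v) (auto simp: cons_reduce_cancel' word_mult_reduced)

lemma word_mult_assoc:
  "reduced w \<Longrightarrow> word_mult (word_mult u v) w = word_mult u (word_mult v w)"
  by (induction u) (auto simp: word_mult_cons_reduce)

lemma word_mult_inverse: "reduced w \<Longrightarrow> word_mult (rev (map letter_inv u)) (word_mult u w) = w"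
  by (induction u arbitrary: w)
     (auto simp: word_mult_append cons_reduce_cancel word_mult_reduced)

lemma group_free_group: "group (free_group X)"
proof (rule groupI)
  fix u v assume "u \<in> carrier (free_group X)" "v \<in> carrier (free_group X)"
  then show "u \<otimes>\<^bsub>free_group X\<^esub> v \<in> carrier (free_group X)"
    using snd_set_word_mult[of u v]
    by (auto simp: free_group_def word_mult_reduced dest: subset_trans)
next
  fix u assume u: "u \<in> carrier (free_group X)"
  define v where "v = word_mult (rev (map letter_inv u)) []"
  have "snd ` set v \<subseteq> X"
    using u snd_set_word_mult[of "rev (map letter_inv u)" "[]"]
    by (simp add: v_def free_group_def image_image) blast
  moreover have "word_mult v u = []"
  proof -
    have "word_mult v u = word_mult (rev (map letter_inv u)) (word_mult u [])"
      using u by (simp add: v_def word_mult_assoc free_group_def word_mult_Nil_right)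
    then show ?thesis by (simp add: word_mult_inverse)
  qed
  moreover have "reduced v"
    by (simp add: v_def word_mult_reduced)
  ultimately show "\<exists>v\<in>carrier (free_group X). v \<otimes>\<^bsub>free_group X\<^esub> u = \<one>\<^bsub>free_group X\<^esub>"
    by (auto simp: free_group_def)
qed (auto simp: free_group_def word_mult_assoc)

context
  fixes H :: "('b, 'c) monoid_scheme" and f :: "'a \<Rightarrow> 'b" and X :: "'a set"
  assumes H: "group H" and f: "f \<in> X \<rightarrow> carrier H"
begin

interpretation H: group H by (fact H)

private definition letter_value :: "bool \<times> 'a \<Rightarrow> 'b" where
  "letter_value a = (if fst a then inv\<^bsub>H\<^esub> (f (snd a)) else f (snd a))"

private definition word_value :: "'a word \<Rightarrow> 'b" where
  "word_value w = foldr (\<lambda>a g. letter_value a \<otimes>\<^bsub>H\<^esub> g) w \<one>\<^bsub>H\<^esub>"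

private lemma letter_value_closed: "snd a \<in> X \<Longrightarrow> letter_value a \<in> carrier H"
  using f by (auto simp: letter_value_def)

private lemma word_value_Cons [simp]: "word_value (a # w) = letter_value a \<otimes>\<^bsub>H\<^esub> word_value w"
  by (simp add: word_value_def)

private lemma word_value_closed: "snd ` set w \<subseteq> X \<Longrightarrow> word_value w \<in> carrier H"
  by (induction w) (auto simp: word_value_def letter_value_closed)

private lemma letter_value_inv: "snd a \<in> X \<Longrightarrow> letter_value (letter_inv a) = inv\<^bsub>H\<^esub> (letter_value a)"
  using funcset_mem[OF f] by (auto simp: letter_value_def letter_inv_def)

private lemma word_value_cons_reduce:
  assumes "snd a \<in> X" "snd ` set w \<subseteq> X"
  shows "word_value (cons_reduce a w) = letter_value a \<otimes>\<^bsub>H\<^esub> word_value w"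
  using assms
  by (cases w)
     (auto simp: letter_value_inv letter_value_closed word_value_closed simp flip: H.m_assoc)

private lemma word_value_mult:
  assumes "snd ` set u \<subseteq> X" "snd ` set w \<subseteq> X"
  shows "word_value (word_mult u w) = word_value u \<otimes>\<^bsub>H\<^esub> word_value w"
  using assms
proof (induction u)
  case Nil
  then show ?case by (simp add: word_value_def[of "[]"] word_value_closed)
next
  case (Cons a u)
  have "snd ` set (word_mult u w) \<subseteq> X"
    using snd_set_word_mult[of u w] Cons.prems by simp blast
  with Cons show ?case
    by (simp add: word_value_cons_reduce letter_value_closed word_value_closed H.m_assoc)
qed

lemma free_group_universal_exists:
  "\<exists>h\<in>hom (free_group X) H. \<forall>x\<in>X. h [(False, x)] = f x"
proof (rule bexI[of _ word_value])
  show "word_value \<in> hom (free_group X) H"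
    by (rule homI) (simp_all add: free_group_def word_value_closed word_value_mult)
  show "\<forall>x\<in>X. word_value [(False, x)] = f x"
    using f by (auto simp: word_value_def letter_value_def Pi_iff)
qed

end

lemma free_group_universal_unique:
  assumes H: "group H"
    and h: "h \<in> hom (free_group X) H" and h': "h' \<in> hom (free_group X) H"
    and eq: "\<And>x. x \<in> X \<Longrightarrow> h [(False, x)] = h' [(False, x)]"
    and w: "w \<in> carrier (free_group X)"
  shows "h w = h' w"
proof -
  interpret h: group_hom "free_group X" H h
    by (simp add: group_hom_def group_hom_axioms_def H h group_free_group)
  interpret h': group_hom "free_group X" H h'
    by (simp add: group_hom_def group_hom_axioms_def H h' group_free_group)
  have letter: "h [a] = h' [a]" if "snd a \<in> X" for a
  proof (cases "fst a")
    case False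
    then show ?thesis using eq[OF that] by (cases a) auto
  next
    case True
    let ?x = "[(False, snd a)]"
    have x: "?x \<in> carrier (free_group X)" using that by (simp add: free_group_def)
    have "[a] \<otimes>\<^bsub>free_group X\<^esub> ?x = \<one>\<^bsub>free_group X\<^esub>"
      using True by (cases a) (simp add: free_group_def letter_inv_def)
    moreover have "[a] \<in> carrier (free_group X)" using that by (simp add: free_group_def)
    ultimately have "[a] = inv\<^bsub>free_group X\<^esub> ?x"
      using x by (metis h.G.inv_equality)
    then show ?thesis using x eq[OF that] by simp
  qed
  show ?thesis using w
  proof (induction w)
    case Nil
    then show ?case using h.hom_one h'.hom_one by (simp add: free_group_def)
  next
    case (Cons a w)
    then have a: "snd a \<in> X" "[a] \<in> carrier (free_group X)" and w: "w \<in> carrier (free_group X)"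
      by (auto simp: free_group_def dest: reduced_ConsD)
    have aw: "a # w = [a] \<otimes>\<^bsub>free_group X\<^esub> w"
      using Cons.prems by (simp add: free_group_def cons_reduce_Cons)
    show ?case
      unfolding aw using a w letter Cons.IH by simp
  qed
qed


section \<open>The space of marked groups\<close>

text \<open>The basis of \<open>F k\<close> is indexed by \<open>1, \<dots>, k\<close>; the marked group corresponding to a normal
  subgroup \<open>N\<close> is \<open>F k Mod N\<close>.\<close>

abbreviation F :: "nat \<Rightarrow> nat word monoid" where
  "F k \<equiv> free_group {1..k}"

definition marked_groups :: "nat \<Rightarrow> nat word set set" where
  "marked_groups k = {N. N \<lhd> F k}"

definition marked_dist :: "nat word set \<Rightarrow> nat word set \<Rightarrow> real" where
  "marked_dist M N =
     (if M = N then 0 else (GREATEST r. r \<in> (\<lambda>w. 1 / real (length w)) ` sym_diff M N))"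

definition marked_space :: "nat \<Rightarrow> nat word set topology" where
  "marked_space k = Metric_space.mtopology (marked_groups k) marked_dist"

text \<open>The maximum in the definition of the metric is attained (also for arbitrary sets of words,
  where \<open>1 / 0 = 0\<close> for the empty word).\<close>

lemma marked_dist_max:
  assumes "M \<noteq> N"
  shows "marked_dist M N \<in> (\<lambda>w. 1 / real (length w)) ` sym_diff M N"
    and "\<And>w. w \<in> sym_diff M N \<Longrightarrow> 1 / real (length w) \<le> marked_dist M N"
proof -
  define D where "D = sym_diff M N"
  let ?S = "(\<lambda>w. 1 / real (length w)) ` D"
  have "D \<noteq> {}" using assms unfolding D_def by blast
  have "\<exists>r\<in>?S. \<forall>s\<in>?S. s \<le> r"
  proof (cases "\<exists>w\<in>D. w \<noteq> []")
    case True
    then obtain w where w: "w \<in> D" "w \<noteq> []"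
      and min: "\<And>v. v \<in> D \<Longrightarrow> v \<noteq> [] \<Longrightarrow> length w \<le> length v"
      using ex_has_least_nat[of "\<lambda>w. w \<in> D \<and> w \<noteq> []" _ length] by blast
    have "1 / real (length v) \<le> 1 / real (length w)" if "v \<in> D" for v
      using min[OF that] w(2) by (cases "v = []") (auto intro!: divide_left_mono)
    then show ?thesis using w(1) by blast
  next
    case False
    with \<open>D \<noteq> {}\<close> show ?thesis by auto
  qed
  then obtain r where r: "r \<in> ?S" "\<And>s. s \<in> ?S \<Longrightarrow> s \<le> r" by blast
  then have "(GREATEST r. r \<in> ?S) = r"
    by (intro Greatest_equality)
  then have "marked_dist M N = r" using assms by (simp add: marked_dist_def D_def)
  with r have "marked_dist M N \<in> ?S" "\<forall>w\<in>D. 1 / real (length w) \<le> marked_dist M N"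
    by auto
  then show "marked_dist M N \<in> (\<lambda>w. 1 / real (length w)) ` sym_diff M N"
    and "\<And>w. w \<in> sym_diff M N \<Longrightarrow> 1 / real (length w) \<le> marked_dist M N"
    unfolding D_def by simp_all
qed

lemma marked_dist_nonneg: "0 \<le> marked_dist M N"
  using marked_dist_max(1)[of M N] by (cases "M = N") (auto simp: marked_dist_def)

lemma marked_dist_ultrametric: "marked_dist M N \<le> max (marked_dist M L) (marked_dist L N)"
proof (cases "M = N")
  case True
  then show ?thesis by (simp add: marked_dist_def[of N N] marked_dist_nonneg le_max_iff_disj)
next
  case False
  then obtain w where w: "w \<in> sym_diff M N" "marked_dist M N = 1 / real (length w)"
    using marked_dist_max(1)[OF False] by blast
  then consider "w \<in> sym_diff M L" | "w \<in> sym_diff L N" by blast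
  then show ?thesis
  proof cases
    case 1
    then have "M \<noteq> L" by blast
    from marked_dist_max(2)[OF this 1] show ?thesis using w by simp
  next
    case 2
    then have "L \<noteq> N" by blast
    from marked_dist_max(2)[OF this 2] show ?thesis using w by simp
  qed
qed

lemma Metric_space_marked_groups: "Metric_space (marked_groups k) marked_dist"
proof
  fix M N L :: "nat word set"
  show "0 \<le> marked_dist M N" by (rule marked_dist_nonneg)
  show "marked_dist M N = marked_dist N M"
    by (simp add: marked_dist_def Un_commute eq_commute[of M N])
  show "marked_dist M L \<le> marked_dist M N + marked_dist N L"
    using marked_dist_ultrametric[of M L N] marked_dist_nonneg[of M N] marked_dist_nonneg[of N L]
    by linarith
  assume "M \<in> marked_groups k" "N \<in> marked_groups k"
  then have "[] \<in> M" "[] \<in> N"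
    using subgroup.one_closed[OF normal_imp_subgroup, of _ "F k"]
    by (auto simp: marked_groups_def free_group_def)
  then have "0 < length w" if "w \<in> sym_diff M N" for w
    using that by auto
  then show "marked_dist M N = 0 \<longleftrightarrow> M = N"
    using marked_dist_max(1)[of M N] by (cases "M = N") (fastforce simp: marked_dist_def[of N N])+
qed

lemma topspace_marked_space [simp]: "topspace (marked_space k) = marked_groups k"
  by (simp add: marked_space_def Metric_space.topspace_mtopology Metric_space_marked_groups)


section \<open>Group-theoretic properties\<close>

definition group_topology :: "('a, 'b) monoid_scheme \<Rightarrow> 'a topology \<Rightarrow> bool" where
  "group_topology G T \<longleftrightarrow>
     topspace T = carrier G \<and>
     continuous_map (prod_topology T T) T (\<lambda>(x, y). x \<otimes>\<^bsub>G\<^esub> y) \<and>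
     continuous_map T T (\<lambda>x. inv\<^bsub>G\<^esub> x)"

definition topologizable :: "('a, 'b) monoid_scheme \<Rightarrow> bool" where
  "topologizable G \<longleftrightarrow>
     group G \<and>
     (\<exists>T. group_topology G T \<and> Hausdorff_space T \<and> T \<noteq> discrete_topology (carrier G))"

definition finitely_generated_group :: "('a, 'b) monoid_scheme \<Rightarrow> bool" where
  "finitely_generated_group G \<longleftrightarrow>
     group G \<and> (\<exists>S. finite S \<and> S \<subseteq> carrier G \<and> generate G S = carrier G)"

text \<open>The locale \<open>simple_group\<close> of \<open>HOL-Algebra\<close> requires \<open>order G > 1\<close>, where \<open>order G = 0\<close> for
  infinite \<open>G\<close>; it therefore excludes infinite groups and cannot be used here.\<close>

definition simple :: "('a, 'b) monoid_scheme \<Rightarrow> bool" where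
  "simple G \<longleftrightarrow>
     group G \<and> carrier G \<noteq> {\<one>\<^bsub>G\<^esub>} \<and>
     (\<forall>N. N \<lhd> G \<longrightarrow> N = carrier G \<or> N = {\<one>\<^bsub>G\<^esub>})"

definition Tarski_monster :: "('a, 'b) monoid_scheme \<Rightarrow> bool" where
  "Tarski_monster G \<longleftrightarrow>
     finitely_generated_group G \<and> infinite (carrier G) \<and> simple G \<and>
     (\<forall>H. subgroup H G \<and> H \<noteq> carrier G \<longrightarrow> finite H \<and> cyclic_group (G\<lparr>carrier := H\<rparr>))"

text \<open>The exponent \<open>n\<close> need not be minimal.\<close>

definition finite_exponent :: "nat \<Rightarrow> ('a, 'b) monoid_scheme \<Rightarrow> bool" where
  "finite_exponent n G \<longleftrightarrow> 0 < n \<and> (\<forall>g\<in>carrier G. g [^]\<^bsub>G\<^esub> n = \<one>\<^bsub>G\<^esub>)"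

end

theory Submission
  imports Defs "HOL-Algebra.Multiplicative_Group"
begin

text \<open>
Membership of a fixed word in \<open>N\<close> is a clopen condition on \<open>N\<close>. Hence an equation or an inequation
between two given elements of \<open>F k Mod N\<close> is clopen, the existence of elements (represented by words)
satisfying finitely many of them is open, and, since there are only countably many words, any property
of the form ``for all words there exist words such that \<open>\<dots>\<close>'' defines a \<open>G\<^sub>\<delta>\<close> set. It remains to
describe both properties in this form.

For topologizability this is Markov's criterion: a countable group \<open>G\<close> is topologizable iff for all words
\<open>t\<^sub>1(x), \<dots>, t\<^sub>m(x)\<close> in one variable with coefficients in \<open>G\<close> and \<open>t\<^sub>i(1) \<noteq> 1\<close> some \<open>g \<noteq> 1\<close> satisfies
\<open>t\<^sub>i(g) \<noteq> 1\<close> for all \<open>i\<close> (\<open>topologizable_iff_one_not_Zariski_open\<close>). The condition is necessary because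
words are continuous. Conversely, it makes it possible to choose successively nontrivial elements
\<open>g\<^sub>0, g\<^sub>1, \<dots>\<close> and to declare that they converge to \<open>1\<close>: let \<open>U\<^sub>n\<close> consist of what can be generated
from \<open>g\<^sub>n, g\<^sub>n\<^sub>+\<^sub>1, \<dots>\<close> if a product or a conjugation by one of the first elements of \<open>G\<close> lowers
the index by one. Only finitely many elements of \<open>U\<^sub>n\<close> arise without a generator after \<open>g\<^sub>m\<close>, and they are
values of words at \<open>g\<^sub>m\<close>; so \<open>g\<^sub>m\<close> can be chosen such that the \<open>n\<close>-th element of \<open>G\<close>, if nontrivial, stays outside \<open>U\<^sub>n\<close>.
The sets \<open>U\<^sub>n\<close> are then a base of neighbourhoods of the identity for a non-discrete Hausdorff group topology
(locale \<open>neighbourhood_sequence\<close>).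

Among groups of exponent \<open>n\<close> with a given finite generating set, the Tarski monsters are the infinite groups in
which the normal closure of each nontrivial element is everything and any two elements generate either
a cyclic group or everything. Indeed, if all two-generated subgroups of a subgroup are cyclic and
orders are bounded, an element of maximal order generates it (\<open>locally_cyclic_imp_cyclic\<close>).
\<close>

section \<open>Group words in one variable\<close>

text \<open>A group word in one variable with coefficients from \<open>'g\<close>. Words are kept as uninterpreted terms
rather than as functions, so that a single word over the free group can be read in all
of its quotients at once, and so that there are only countably many of them.\<close>

datatype 'g gword = Const 'g | Var | Mult "'g gword" "'g gword" | Inv "'g gword"

instance gword :: (countable) countable
  by countable_datatype

primrec subst :: "('g, 'b) monoid_scheme \<Rightarrow> 'g \<Rightarrow> 'g gword \<Rightarrow> 'g" where
  "subst G x (Const a) = a"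
| "subst G x Var = x"
| "subst G x (Mult s t) = subst G x s \<otimes>\<^bsub>G\<^esub> subst G x t"
| "subst G x (Inv t) = inv\<^bsub>G\<^esub> (subst G x t)"

text \<open>The sets \<open>{x. t(x) = 1}\<close>, with \<open>t\<close> a word in one variable, are a subbase of closed sets for the Zariski
topology of \<open>G\<close>. A finite set of words \<open>t\<close> with \<open>t(1) \<noteq> 1\<close> thus describes a basic open neighbourhood
of the identity, and the condition is that every such neighbourhood has another point.\<close>

definition one_not_Zariski_open :: "('g, 'b) monoid_scheme \<Rightarrow> bool" where
  "one_not_Zariski_open G \<longleftrightarrow>
     (\<forall>T. finite T \<and> (\<forall>t\<in>T. set_gword t \<subseteq> carrier G \<and> subst G \<one>\<^bsub>G\<^esub> t \<noteq> \<one>\<^bsub>G\<^esub>) \<longrightarrow>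
          (\<exists>g\<in>carrier G. g \<noteq> \<one>\<^bsub>G\<^esub> \<and> (\<forall>t\<in>T. subst G g t \<noteq> \<one>\<^bsub>G\<^esub>)))"

lemma (in group) subst_closed:
  assumes "set_gword t \<subseteq> carrier G" "x \<in> carrier G"
  shows "subst G x t \<in> carrier G"
  using assms by (induction t) auto

lemma (in group_hom) subst_hom:
  assumes "set_gword t \<subseteq> carrier G" "x \<in> carrier G"
  shows "subst H (h x) (map_gword h t) = h (subst G x t)"
  using assms by (induction t) (auto simp: G.subst_closed)

lemma (in group) continuous_map_subst:
  assumes T: "group_topology G T" and t: "set_gword t \<subseteq> carrier G"
  shows "continuous_map T T (\<lambda>x. subst G x t)"
  using t
proof (induction t)
  case (Mult s t)
  then have "continuous_map T (prod_topology T T) (\<lambda>x. (subst G x s, subst G x t))"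
    by (simp add: continuous_map_paired)
  from continuous_map_compose[OF this, of T "\<lambda>(x, y). x \<otimes> y"] T show ?case
    by (simp add: group_topology_def o_def)
next
  case (Inv t)
  then have "continuous_map T T (\<lambda>x. subst G x t)" by simp
  from continuous_map_compose[OF this, of T "\<lambda>x. inv x"] T show ?case
    by (simp add: group_topology_def o_def)
qed (use T in \<open>auto simp: group_topology_def\<close>)

text \<open>Words define continuous maps for every group topology, so by the Hausdorff property every Zariski
neighbourhood of the identity is a neighbourhood for that topology. If one of them were \<open>{1}\<close>, all
singletons would be open by translation.\<close>

lemma (in group) one_not_Zariski_open_if_topologizable:
  assumes "topologizable G"
  shows "one_not_Zariski_open G"
  unfolding one_not_Zariski_open_def
proof (intro allI impI, elim conjE)
  obtain T where T: "group_topology G T" "Hausdorff_space T" "T \<noteq> discrete_topology (carrier G)"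
    using assms by (auto simp: topologizable_def)
  then have top: "topspace T = carrier G" by (simp add: group_topology_def)
  fix S :: "'a gword set"
  assume "finite S" and S: "\<forall>t\<in>S. set_gword t \<subseteq> carrier G \<and> subst G \<one> t \<noteq> \<one>"
  define W where "W = topspace T \<inter> (\<Inter>t\<in>S. {x \<in> topspace T. subst G x t \<in> carrier G - {\<one>}})"
  have "openin T (carrier G - {\<one>})"
    using closedin_Hausdorff_singleton[OF T(2), of \<one>] by (simp add: top closedin_def)
  then have "openin T {x \<in> topspace T. subst G x t \<in> carrier G - {\<one>}}" if "t \<in> S" for t
    using S that by (intro openin_continuous_map_preimage[OF continuous_map_subst[OF T(1)]]) auto
  then have W: "openin T W"
    unfolding W_def using \<open>finite S\<close> by (intro openin_Int_Inter) auto
  have "\<one> \<in> W" using S by (auto simp: W_def top subst_closed)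
  show "\<exists>g\<in>carrier G. g \<noteq> \<one> \<and> (\<forall>t\<in>S. subst G g t \<noteq> \<one>)"
  proof (rule ccontr)
    assume "\<not> ?thesis"
    then have "W = {\<one>}" using \<open>\<one> \<in> W\<close> by (auto simp: W_def top)
    with W have one: "openin T {\<one>}" by simp
    have "openin T {x}" if x: "x \<in> carrier G" for x
    proof -
      have "openin T {y \<in> topspace T. subst G y (Mult (Const (inv x)) Var) \<in> {\<one>}}"
        by (rule openin_continuous_map_preimage[OF continuous_map_subst[OF T(1)] one]) (use x in auto)
      also have "{y \<in> topspace T. subst G y (Mult (Const (inv x)) Var) \<in> {\<one>}} = {x}"
        using x by (auto simp: top) (metis inv_closed inv_equality inv_inv)
      finally show ?thesis .
    qed
    then have "T = discrete_topology (carrier G)"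
      using top by (simp add: discrete_topology_unique eq_commute[of T])
    with T(3) show False by contradiction
  qed
qed

section \<open>Group topologies from neighbourhoods of the identity\<close>

text \<open>A neighbourhood base of the identity for a group topology, in the form in which the sets built below
satisfy it. Symmetry and closure under products, at the cost of passing to smaller sets, are
both contained in the closure under quotients because \<open>1\<close> belongs to every set.\<close>

locale neighbourhood_sequence = group G for G (structure) +
  fixes U :: "nat \<Rightarrow> 'a set"
  assumes U_carrier: "U n \<subseteq> carrier G"
    and one_U: "\<one> \<in> U n"
    and U_Suc: "U (Suc n) \<subseteq> U n"
    and U_div: "\<And>x y. x \<in> U (Suc n) \<Longrightarrow> y \<in> U (Suc n) \<Longrightarrow> x \<otimes> inv y \<in> U n"
    and U_conj: "\<And>c. c \<in> carrier G \<Longrightarrow> \<exists>m. \<forall>x\<in>U m. c \<otimes> x \<otimes> inv c \<in> U n"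
begin

definition nbhd_open :: "'a set \<Rightarrow> bool" where
  "nbhd_open V \<longleftrightarrow> V \<subseteq> carrier G \<and> (\<forall>x\<in>V. \<exists>n. \<forall>u\<in>U n. x \<otimes> u \<in> V)"

definition nbhd_topology :: "'a topology" where
  "nbhd_topology = topology nbhd_open"

lemma U_mem: "x \<in> U n \<Longrightarrow> x \<in> carrier G"
  using U_carrier by blast

lemma U_antimono: "m \<le> n \<Longrightarrow> U n \<subseteq> U m"
  by (rule lift_Suc_antimono_le[of U]) (rule U_Suc)

lemma U_inv: "x \<in> U (Suc n) \<Longrightarrow> inv x \<in> U n"
  using U_div[OF one_U, of x n] by (simp add: U_mem)

lemma U_mult: "x \<in> U (Suc (Suc n)) \<Longrightarrow> y \<in> U (Suc (Suc n)) \<Longrightarrow> x \<otimes> y \<in> U n"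
  using U_div[of x n "inv y"] U_inv[of y "Suc n"] U_Suc[of "Suc n"] by (auto simp: U_mem)

lemma openin_nbhd_topology: "openin nbhd_topology V \<longleftrightarrow> nbhd_open V"
proof -
  have "nbhd_open (V \<inter> W)" if V: "nbhd_open V" and W: "nbhd_open W" for V W
    unfolding nbhd_open_def
  proof (intro conjI ballI)
    show "V \<inter> W \<subseteq> carrier G" using V by (auto simp: nbhd_open_def)
    fix x assume "x \<in> V \<inter> W"
    then obtain m n where "\<forall>u\<in>U m. x \<otimes> u \<in> V" "\<forall>u\<in>U n. x \<otimes> u \<in> W"
      using V W unfolding nbhd_open_def by blast
    then show "\<exists>n. \<forall>u\<in>U n. x \<otimes> u \<in> V \<inter> W"
      using U_antimono[of m "max m n"] U_antimono[of n "max m n"]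
      by (intro exI[of _ "max m n"]) auto
  qed
  moreover have "nbhd_open (\<Union>\<V>)" if "\<forall>V\<in>\<V>. nbhd_open V" for \<V>
    using that unfolding nbhd_open_def by (fastforce simp: Sup_le_iff)
  ultimately have "istopology nbhd_open" by (simp add: istopology_def)
  then show ?thesis by (simp add: nbhd_topology_def)
qed

lemma topspace_nbhd_topology: "topspace nbhd_topology = carrier G"
proof
  show "topspace nbhd_topology \<subseteq> carrier G"
    using openin_nbhd_topology[of "topspace nbhd_topology"] by (simp add: nbhd_open_def)
  show "carrier G \<subseteq> topspace nbhd_topology"
    by (rule openin_subset) (auto simp: openin_nbhd_topology nbhd_open_def U_mem)
qed

text \<open>The coset \<open>x U n\<close> need not be open itself, but the set of all \<open>y\<close> such that it contains some coset
\<open>y U m\<close> is.\<close>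

lemma open_neighbourhood:
  assumes x: "x \<in> carrier G"
  obtains V where "openin nbhd_topology V" "x \<in> V" "\<And>y. y \<in> V \<Longrightarrow> \<exists>u\<in>U n. y = x \<otimes> u"
proof
  define V where "V = {y \<in> carrier G. \<exists>m. \<forall>u\<in>U m. y \<otimes> u \<in> (\<otimes>) x ` U n}"
  show "openin nbhd_topology V"
    unfolding openin_nbhd_topology nbhd_open_def
  proof (intro conjI ballI)
    show "V \<subseteq> carrier G" by (auto simp: V_def)
    fix y assume "y \<in> V"
    then obtain m where y: "y \<in> carrier G" and m: "\<And>u. u \<in> U m \<Longrightarrow> y \<otimes> u \<in> (\<otimes>) x ` U n"
      by (auto simp: V_def)
    have "y \<otimes> u \<in> V" if u: "u \<in> U (Suc (Suc m))" for u
      unfolding V_def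
    proof (intro CollectI conjI exI ballI)
      show "y \<otimes> u \<in> carrier G" using u y U_mem by auto
      fix v assume v: "v \<in> U (Suc (Suc m))"
      from m[OF U_mult[OF u v]] show "y \<otimes> u \<otimes> v \<in> (\<otimes>) x ` U n"
        using u v y by (simp add: U_mem m_assoc)
    qed
    then show "\<exists>n. \<forall>u\<in>U n. y \<otimes> u \<in> V" by blast
  qed
  show "x \<in> V" using x by (auto simp: V_def)
  fix y assume "y \<in> V"
  then obtain m where "y \<in> carrier G" "y \<otimes> \<one> \<in> (\<otimes>) x ` U n"
    unfolding V_def using one_U by blast
  then show "\<exists>u\<in>U n. y = x \<otimes> u" by auto
qed

lemma continuous_mult:
  "continuous_map (prod_topology nbhd_topology nbhd_topology) nbhd_topology (\<lambda>(x, y). x \<otimes> y)"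
  unfolding continuous_map_def
proof (intro conjI allI impI)
  show "(\<lambda>(x, y). x \<otimes> y)
      \<in> topspace (prod_topology nbhd_topology nbhd_topology) \<rightarrow> topspace nbhd_topology"
    by (auto simp: topspace_nbhd_topology)
  fix V assume V: "openin nbhd_topology V"
  show "openin (prod_topology nbhd_topology nbhd_topology)
      {p \<in> topspace (prod_topology nbhd_topology nbhd_topology). (case p of (x, y) \<Rightarrow> x \<otimes> y) \<in> V}"
    unfolding openin_prod_topology_alt
  proof (intro allI impI)
    fix x y
    assume "(x, y) \<in> {p \<in> topspace (prod_topology nbhd_topology nbhd_topology).
        (case p of (x, y) \<Rightarrow> x \<otimes> y) \<in> V}"
    then have xy: "x \<in> carrier G" "y \<in> carrier G" "x \<otimes> y \<in> V"
      by (auto simp: topspace_nbhd_topology)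
    obtain n where n: "\<And>u. u \<in> U n \<Longrightarrow> x \<otimes> y \<otimes> u \<in> V"
      using V xy unfolding openin_nbhd_topology nbhd_open_def by blast
    \<comment> \<open>From \<open>x u y v = x y (y\<inverse> u y) v\<close>: the factor \<open>u\<close> has to be small even after conjugation by \<open>y\<inverse>\<close>.\<close>
    obtain m where m: "\<And>u. u \<in> U m \<Longrightarrow> inv y \<otimes> u \<otimes> inv (inv y) \<in> U (Suc (Suc n))"
      using U_conj[of "inv y" "Suc (Suc n)"] xy by auto
    obtain A where A: "openin nbhd_topology A" "x \<in> A" "\<And>a. a \<in> A \<Longrightarrow> \<exists>u\<in>U m. a = x \<otimes> u"
      using open_neighbourhood[OF xy(1), of m] by blast
    obtain B where B: "openin nbhd_topology B" "y \<in> B"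
      "\<And>b. b \<in> B \<Longrightarrow> \<exists>u\<in>U (Suc (Suc n)). b = y \<otimes> u"
      using open_neighbourhood[OF xy(2), of "Suc (Suc n)"] by blast
    have "a \<otimes> b \<in> V" if ab: "a \<in> A" "b \<in> B" for a b
    proof -
      obtain u v where u: "u \<in> U m" "a = x \<otimes> u" and v: "v \<in> U (Suc (Suc n))" "b = y \<otimes> v"
        using A(3) B(3) ab by blast
      have "x \<otimes> y \<otimes> ((inv y \<otimes> u \<otimes> inv (inv y)) \<otimes> v) \<in> V"
        using n U_mult[OF m[OF u(1)] v(1)] by blast
      also have "x \<otimes> y \<otimes> ((inv y \<otimes> u \<otimes> inv (inv y)) \<otimes> v) = x \<otimes> u \<otimes> (y \<otimes> v)"
      proof -
        have "y \<otimes> (inv y \<otimes> z) = z" if "z \<in> carrier G" for z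
          using xy that by (simp flip: m_assoc)
        then show ?thesis using xy U_mem[OF u(1)] U_mem[OF v(1)] by (simp add: m_assoc)
      qed
      finally show ?thesis using u v by simp
    qed
    then have "A \<times> B \<subseteq> {p \<in> topspace (prod_topology nbhd_topology nbhd_topology).
        (case p of (x, y) \<Rightarrow> x \<otimes> y) \<in> V}"
      using openin_subset[OF A(1)] openin_subset[OF B(1)] by auto
    with A B show "\<exists>A B. openin nbhd_topology A \<and> openin nbhd_topology B \<and> x \<in> A \<and> y \<in> B \<and>
        A \<times> B \<subseteq> {p \<in> topspace (prod_topology nbhd_topology nbhd_topology).
          (case p of (x, y) \<Rightarrow> x \<otimes> y) \<in> V}"
      by blast
  qed
qed

lemma continuous_inv: "continuous_map nbhd_topology nbhd_topology (\<lambda>x. inv x)"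
  unfolding continuous_map_def
proof (intro conjI allI impI)
  show "(\<lambda>x. inv x) \<in> topspace nbhd_topology \<rightarrow> topspace nbhd_topology"
    by (auto simp: topspace_nbhd_topology)
  fix V assume V: "openin nbhd_topology V"
  show "openin nbhd_topology {x \<in> topspace nbhd_topology. inv x \<in> V}"
    unfolding openin_nbhd_topology nbhd_open_def
  proof (intro conjI ballI)
    show "{x \<in> topspace nbhd_topology. inv x \<in> V} \<subseteq> carrier G"
      by (auto simp: topspace_nbhd_topology)
    fix x assume "x \<in> {x \<in> topspace nbhd_topology. inv x \<in> V}"
    then have x: "x \<in> carrier G" "inv x \<in> V" by (auto simp: topspace_nbhd_topology)
    then obtain n where n: "\<And>u. u \<in> U n \<Longrightarrow> inv x \<otimes> u \<in> V"
      using V unfolding openin_nbhd_topology nbhd_open_def by blast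
    \<comment> \<open>From \<open>(x u)\<inverse> = x\<inverse> (x u x\<inverse>)\<inverse>\<close>.\<close>
    obtain m where m: "\<And>u. u \<in> U m \<Longrightarrow> x \<otimes> u \<otimes> inv x \<in> U (Suc n)"
      using U_conj[OF x(1), of "Suc n"] by auto
    have "inv (x \<otimes> u) \<in> V" if u: "u \<in> U m" for u
    proof -
      have "inv x \<otimes> inv (x \<otimes> u \<otimes> inv x) \<in> V"
        using n U_inv[OF m[OF u]] by blast
      also have "inv x \<otimes> inv (x \<otimes> u \<otimes> inv x) = inv (x \<otimes> u)"
        using x U_mem[OF u] by (simp add: inv_mult_group flip: m_assoc)
      finally show ?thesis .
    qed
    then show "\<exists>m. \<forall>u\<in>U m. x \<otimes> u \<in> {x \<in> topspace nbhd_topology. inv x \<in> V}"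
      using x U_mem by (auto simp: topspace_nbhd_topology)
  qed
qed

lemma Hausdorff_nbhd_topology:
  assumes "\<And>x. x \<in> carrier G \<Longrightarrow> x \<noteq> \<one> \<Longrightarrow> \<exists>n. x \<notin> U n"
  shows "Hausdorff_space nbhd_topology"
  unfolding Hausdorff_space_def
proof (intro allI impI, elim conjE)
  fix x y assume "x \<in> topspace nbhd_topology" "y \<in> topspace nbhd_topology" "x \<noteq> y"
  then have xy: "x \<in> carrier G" "y \<in> carrier G" "x \<noteq> y" by (simp_all add: topspace_nbhd_topology)
  then have "inv x \<otimes> y \<noteq> \<one>" by (metis inv_closed inv_equality inv_inv)
  then obtain n where n: "inv x \<otimes> y \<notin> U n" using assms[of "inv x \<otimes> y"] xy by auto
  obtain A where A: "openin nbhd_topology A" "x \<in> A" "\<And>a. a \<in> A \<Longrightarrow> \<exists>u\<in>U (Suc n). a = x \<otimes> u"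
    using open_neighbourhood[OF xy(1), of "Suc n"] by blast
  obtain B where B: "openin nbhd_topology B" "y \<in> B" "\<And>b. b \<in> B \<Longrightarrow> \<exists>u\<in>U (Suc n). b = y \<otimes> u"
    using open_neighbourhood[OF xy(2), of "Suc n"] by blast
  have False if ab: "a \<in> A" "a \<in> B" for a
  proof -
    obtain u v where u: "u \<in> U (Suc n)" "a = x \<otimes> u" and v: "v \<in> U (Suc n)" "a = y \<otimes> v"
      using A(3) B(3) ab by blast
    then have uv: "u \<in> carrier G" "v \<in> carrier G" by (auto simp: U_mem)
    have "y = x \<otimes> u \<otimes> inv v" using xy uv u v by (metis inv_solve_right m_closed)
    then have "inv x \<otimes> y = u \<otimes> inv v" using xy uv by (simp add: inv_solve_left' m_assoc)
    with n U_div[OF u(1) v(1)] show False by simp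
  qed
  then have "disjnt A B" by (auto simp: disjnt_def)
  with A B show "\<exists>A B. openin nbhd_topology A \<and> openin nbhd_topology B \<and> x \<in> A \<and> y \<in> B \<and> disjnt A B"
    by blast
qed

lemma topologizable_if_separating:
  assumes sep: "\<And>x. x \<in> carrier G \<Longrightarrow> x \<noteq> \<one> \<Longrightarrow> \<exists>n. x \<notin> U n"
    and nontrivial: "\<And>n. U n \<noteq> {\<one>}"
  shows "topologizable G"
  unfolding topologizable_def
proof (intro conjI exI)
  show "group G" by (rule is_group)
  show "group_topology G nbhd_topology"
    by (simp add: group_topology_def topspace_nbhd_topology continuous_mult continuous_inv)
  show "Hausdorff_space nbhd_topology" by (rule Hausdorff_nbhd_topology[OF sep])
  show "nbhd_topology \<noteq> discrete_topology (carrier G)"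
  proof
    assume "nbhd_topology = discrete_topology (carrier G)"
    then have "openin nbhd_topology {\<one>}" by simp
    then obtain n where "\<And>u. u \<in> U n \<Longrightarrow> \<one> \<otimes> u = \<one>"
      by (auto simp: openin_nbhd_topology nbhd_open_def)
    then have "U n \<subseteq> {\<one>}" using U_mem by auto
    with one_U[of n] nontrivial[of n] show False by blast
  qed
qed

end

section \<open>Markov's criterion for countable groups\<close>

context group
begin

text \<open>The sequence \<open>a\<close> will enumerate the group, and \<open>g\<close> is a sequence of elements meant to converge to the
identity. The union over \<open>d\<close> of these sets is the smallest system \<open>U\<close> with \<open>1, g n \<in> U n\<close> and
\<open>b x y\<inverse> b\<inverse> \<in> U n\<close> for all \<open>x, y \<in> U (n + 1)\<close> and \<open>b \<in> {1, a 0, \<dots>, a n}\<close>; the stage \<open>d\<close> at level \<open>n\<close>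
involves only \<open>g n, \<dots>, g (n + d - 1)\<close>.\<close>

primrec approx_nbhd :: "(nat \<Rightarrow> 'a) \<Rightarrow> (nat \<Rightarrow> 'a) \<Rightarrow> nat \<Rightarrow> nat \<Rightarrow> 'a set" where
  "approx_nbhd a g 0 n = {\<one>}"
| "approx_nbhd a g (Suc d) n = {\<one>, g n} \<union>
     (\<lambda>(b, x, y). b \<otimes> (x \<otimes> inv y) \<otimes> inv b) `
       (insert \<one> (a ` {..n}) \<times> approx_nbhd a g d (Suc n) \<times> approx_nbhd a g d (Suc n))"

lemma one_approx_nbhd: "\<one> \<in> approx_nbhd a g d n"
  by (cases d) auto

lemma approx_nbhd_closed:
  assumes "range a \<subseteq> carrier G" "range g \<subseteq> carrier G"
  shows "approx_nbhd a g d n \<subseteq> carrier G"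
proof (induction d arbitrary: n)
  case (Suc d)
  have "b \<in> carrier G" if "b \<in> insert \<one> (a ` {..n})" for b
    using assms(1) that by auto
  moreover have "x \<in> carrier G" if "x \<in> approx_nbhd a g d (Suc n)" for x
    using Suc.IH that by blast
  ultimately show ?case using assms(2) by auto
qed simp

lemma approx_nbhd_step:
  assumes "b = \<one> \<or> b \<in> a ` {..n}" "x \<in> approx_nbhd a g d (Suc n)" "y \<in> approx_nbhd a g d (Suc n)"
  shows "b \<otimes> (x \<otimes> inv y) \<otimes> inv b \<in> approx_nbhd a g (Suc d) n"
  using assms by (auto intro!: image_eqI[of _ _ "(b, x, y)"])

lemma approx_nbhd_mono: "d \<le> d' \<Longrightarrow> approx_nbhd a g d n \<subseteq> approx_nbhd a g d' n"
proof (rule lift_Suc_mono_le[of "\<lambda>d. approx_nbhd a g d n"])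
  show "approx_nbhd a g d n \<subseteq> approx_nbhd a g (Suc d) n" for d
  proof (induction d arbitrary: n)
    case (Suc d)
    then show ?case
      unfolding approx_nbhd.simps(2)[of a g "Suc d"]
      by (subst approx_nbhd.simps(2)) (intro Un_mono image_mono Sigma_mono order_refl)
  qed simp
qed

lemma approx_nbhd_cong:
  assumes "\<And>i. n \<le> i \<Longrightarrow> i < n + d \<Longrightarrow> g i = g' i"
  shows "approx_nbhd a g d n = approx_nbhd a g' d n"
  using assms
proof (induction d arbitrary: n)
  case (Suc d)
  have "approx_nbhd a g d (Suc n) = approx_nbhd a g' d (Suc n)"
    by (rule Suc.IH) (use Suc.prems in auto)
  with Suc.prems[of n] show ?case by simp
qed simp

text \<open>If the last generator that stage \<open>d + 1\<close> involves is trivial, nothing new arises. Hence setting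
a new generator to \<open>1\<close> gives back the sets already controlled.\<close>

lemma approx_nbhd_last_one:
  assumes "range a \<subseteq> carrier G" "g (n + d) = \<one>"
  shows "approx_nbhd a g (Suc d) n = approx_nbhd a g d n"
  using assms(2)
proof (induction d arbitrary: n)
  case 0
  have "b \<in> carrier G" if "b \<in> insert \<one> (a ` {..n})" for b
    using assms(1) that by auto
  then show ?case using 0 by auto
next
  case (Suc d)
  then have "approx_nbhd a g (Suc d) (Suc n) = approx_nbhd a g d (Suc n)" by simp
  then show ?case by (simp only: approx_nbhd.simps(2)[of a g "Suc d"] approx_nbhd.simps(2)[of a g d n])
qed

text \<open>As a function of the single generator \<open>g m\<close>, each approximation consists of the values of finitely
many words; avoiding prescribed elements is then a condition about Zariski neighbourhoods.\<close>

lemma approx_nbhd_words: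
  assumes "range a \<subseteq> carrier G" "range g \<subseteq> carrier G"
  shows "\<exists>T. finite T \<and> (\<forall>t\<in>T. set_gword t \<subseteq> carrier G) \<and>
           (\<forall>x\<in>carrier G. approx_nbhd a (g(m := x)) d n = subst G x ` T)"
proof (induction d arbitrary: n)
  case 0
  show ?case by (intro exI[of _ "{Const \<one>}"]) simp
next
  case (Suc d)
  from Suc.IH[of "Suc n"] obtain T where T: "finite T" "\<forall>t\<in>T. set_gword t \<subseteq> carrier G"
    and eq: "\<And>x. x \<in> carrier G \<Longrightarrow> approx_nbhd a (g(m := x)) d (Suc n) = subst G x ` T"
    by (elim exE conjE) simp
  let ?B = "insert \<one> (a ` {..n})"
  let ?c = "\<lambda>(b, s, t). Mult (Mult (Const b) (Mult s (Inv t))) (Inv (Const b))"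
  define S where "S = {Const \<one>, if n = m then Var else Const (g n)} \<union> ?c ` (?B \<times> T \<times> T)"
  have B: "b \<in> carrier G" if "b \<in> ?B" for b using assms(1) that by auto
  have "finite S" using T(1) by (simp add: S_def)
  moreover have "\<forall>t\<in>S. set_gword t \<subseteq> carrier G"
  proof
    fix t assume "t \<in> S"
    then consider "t = Const \<one>" | "t = (if n = m then Var else Const (g n))"
      | b r s where "b \<in> ?B" "r \<in> T" "s \<in> T" "t = ?c (b, r, s)"
      unfolding S_def by blast
    then show "set_gword t \<subseteq> carrier G"
    proof cases
      case 2
      then show ?thesis using assms(2) by auto
    next
      case 3
      with T(2) B show ?thesis by simp
    qed simp
  qed
  moreover have "approx_nbhd a (g(m := x)) (Suc d) n = subst G x ` S" if "x \<in> carrier G" for x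
  proof -
    have "subst G x ` (?c ` (?B \<times> T \<times> T)) =
        (\<lambda>(b, x, y). b \<otimes> (x \<otimes> inv y) \<otimes> inv b) ` (?B \<times> subst G x ` T \<times> subst G x ` T)"
    proof -
      have "B \<times> f ` T \<times> f ` T = (\<lambda>(b, r, s). (b, f r, f s)) ` (B \<times> T \<times> T)"
        for B :: "'a set" and f :: "'a gword \<Rightarrow> 'a"
        by (auto simp: image_iff)
      then show ?thesis by (simp only: image_image) (simp add: case_prod_unfold)
    qed
    then show ?thesis using eq[OF that] by (simp add: S_def image_Un)
  qed
  ultimately show ?case by blast
qed

text \<open>The words \<open>t(x) (a n)\<inverse>\<close>, where \<open>t\<close> runs through the words that describe the enlarged sets, are
nontrivial at \<open>x = 1\<close> because there the sets are the old ones, which avoid \<open>a n\<close>. So the hypothesis on \<open>G\<close> provides a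
nontrivial \<open>x\<close> at which none of them vanishes.\<close>

lemma extend_avoiding:
  assumes G: "one_not_Zariski_open G"
    and a: "range a \<subseteq> carrier G" and g: "range g \<subseteq> carrier G"
    and avoid: "\<And>n. n \<le> m \<Longrightarrow> a n \<noteq> \<one> \<Longrightarrow> a n \<notin> approx_nbhd a g (m - n) n"
  obtains x where "x \<in> carrier G" "x \<noteq> \<one>"
    "\<And>n. n \<le> m \<Longrightarrow> a n \<noteq> \<one> \<Longrightarrow> a n \<notin> approx_nbhd a (g(m := x)) (Suc (m - n)) n"
proof -
  have a': "a n \<in> carrier G" for n using a by blast
  have "\<forall>n. \<exists>T. finite T \<and> (\<forall>t\<in>T. set_gword t \<subseteq> carrier G) \<and>
      (\<forall>x\<in>carrier G. approx_nbhd a (g(m := x)) (Suc (m - n)) n = subst G x ` T)"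
    by (intro allI approx_nbhd_words[OF a g])
  then obtain T where "\<forall>n. finite (T n) \<and> (\<forall>t\<in>T n. set_gword t \<subseteq> carrier G) \<and>
      (\<forall>x\<in>carrier G. approx_nbhd a (g(m := x)) (Suc (m - n)) n = subst G x ` T n)"
    by (rule choice[THEN exE])
  then have T: "\<And>n. finite (T n)" "\<And>n t. t \<in> T n \<Longrightarrow> set_gword t \<subseteq> carrier G"
    and eq: "\<And>n x. x \<in> carrier G \<Longrightarrow> approx_nbhd a (g(m := x)) (Suc (m - n)) n = subst G x ` T n"
    by simp_all
  define S where "S = (\<Union>n\<in>{n. n \<le> m \<and> a n \<noteq> \<one>}. (\<lambda>t. Mult t (Const (inv (a n)))) ` T n)"
  have one: "a n \<notin> subst G \<one> ` T n" if n: "n \<le> m" "a n \<noteq> \<one>" for n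
  proof -
    have "approx_nbhd a (g(m := \<one>)) (Suc (m - n)) n = approx_nbhd a (g(m := \<one>)) (m - n) n"
      by (rule approx_nbhd_last_one[OF a]) (use n in auto)
    also have "\<dots> = approx_nbhd a g (m - n) n"
      by (rule approx_nbhd_cong) (use n in auto)
    finally show ?thesis using avoid[OF n] eq[OF one_closed, of n] by simp
  qed
  have neq: "y \<otimes> inv z = \<one> \<longleftrightarrow> y = z" if "y \<in> carrier G" "z \<in> carrier G" for y z
    using that by (metis inv_closed inv_equality inv_inv r_inv)
  have "finite S" using T(1) by (simp add: S_def)
  moreover have "set_gword t \<subseteq> carrier G \<and> subst G \<one> t \<noteq> \<one>" if "t \<in> S" for t
  proof -
    from that obtain n s where "n \<le> m" "a n \<noteq> \<one>" "s \<in> T n" "t = Mult s (Const (inv (a n)))"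
      by (auto simp: S_def)
    moreover from this have "subst G \<one> s \<noteq> a n" using one[of n] by (metis image_eqI)
    ultimately show ?thesis using T(2)[of s n] a'[of n] by (auto simp: neq subst_closed)
  qed
  ultimately obtain x where x: "x \<in> carrier G" "x \<noteq> \<one>" "\<And>t. t \<in> S \<Longrightarrow> subst G x t \<noteq> \<one>"
    using G unfolding one_not_Zariski_open_def by meson
  have "a n \<notin> approx_nbhd a (g(m := x)) (Suc (m - n)) n" if n: "n \<le> m" "a n \<noteq> \<one>" for n
  proof
    assume "a n \<in> approx_nbhd a (g(m := x)) (Suc (m - n)) n"
    then obtain t where t: "t \<in> T n" "a n = subst G x t" using eq x by blast
    have "Mult t (Const (inv (a n))) \<in> S" using n t(1) by (auto simp: S_def)
    from x(3)[OF this] t a'[of n] show False by simp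
  qed
  with x show ?thesis using that by blast
qed

text \<open>An approximation depends on finitely many generators only, so what the successive extensions avoid is
also avoided by their limit.\<close>

lemma avoiding_sequence:
  assumes G: "one_not_Zariski_open G" and a: "range a \<subseteq> carrier G"
  obtains h where "range h \<subseteq> carrier G" "\<And>i. h i \<noteq> \<one>"
    "\<And>n d. a n \<noteq> \<one> \<Longrightarrow> a n \<notin> approx_nbhd a h d n"
proof -
  \<comment> \<open>Stage \<open>m - n\<close> at level \<open>n\<close> is the part that depends on the generators \<open>g i\<close> with \<open>i < m\<close>, the ones
     chosen after \<open>m\<close> steps.\<close>
  define P where "P = (\<lambda>m g. range g \<subseteq> carrier G \<and>
    (\<forall>n\<le>m. a n \<noteq> \<one> \<longrightarrow> a n \<notin> approx_nbhd a g (m - n) n))"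
  define Q where "Q = (\<lambda>(m :: nat) g g'. \<exists>x. x \<noteq> \<one> \<and> g' = g(m := x))"
  have "\<exists>f. \<forall>m. P m (f m) \<and> Q m (f m) (f (Suc m))"
  proof (rule dependent_nat_choice)
    show "\<exists>g. P 0 g" by (rule exI[of _ "\<lambda>_. \<one>"]) (auto simp: P_def)
    fix g m assume P: "P m g"
    then have g: "range g \<subseteq> carrier G" by (simp add: P_def)
    obtain x where x: "x \<in> carrier G" "x \<noteq> \<one>"
      "\<And>n. n \<le> m \<Longrightarrow> a n \<noteq> \<one> \<Longrightarrow> a n \<notin> approx_nbhd a (g(m := x)) (Suc (m - n)) n"
      by (rule extend_avoiding[OF G a g, of m]) (use P in \<open>auto simp: P_def\<close>)
    have "a n \<notin> approx_nbhd a (g(m := x)) (Suc m - n) n" if "n \<le> Suc m" "a n \<noteq> \<one>" for n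
      using x(3)[of n] that by (cases "n = Suc m") (auto simp: Suc_diff_le)
    moreover have "range (g(m := x)) \<subseteq> carrier G" using g x(1) by auto
    ultimately have "P (Suc m) (g(m := x))" by (simp add: P_def)
    with x(2) show "\<exists>g'. P (Suc m) g' \<and> Q m g g'" by (auto simp: Q_def)
  qed
  then obtain f where P: "\<And>m. P m (f m)" and Q: "\<And>m. Q m (f m) (f (Suc m))" by blast
  define h where "h i = f (Suc i) i" for i
  have f_h: "f m i = h i" if "i < m" for m i
    using that
  proof (induction m)
    case (Suc m)
    then show ?case using Q[of m] by (cases "i = m") (auto simp: Q_def h_def)
  qed simp
  show ?thesis
  proof
    show "range h \<subseteq> carrier G" using P by (auto simp: P_def h_def)
    show "h i \<noteq> \<one>" for i using Q[of i] by (auto simp: Q_def h_def)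
    show "a n \<notin> approx_nbhd a h d n" if n: "a n \<noteq> \<one>" for n d
    proof -
      have "a n \<notin> approx_nbhd a (f (n + d)) d n"
        using P[of "n + d"] n unfolding P_def by (auto dest: spec[of _ n])
      also have "approx_nbhd a (f (n + d)) d n = approx_nbhd a h d n"
        by (rule approx_nbhd_cong) (simp add: f_h)
      finally show ?thesis .
    qed
  qed
qed

text \<open>Markov's criterion. Countability serves to impose all conditions on the neighbourhoods one after
the other: at step \<open>m\<close> the conjugations by \<open>a 0, \<dots>, a m\<close> are taken into account, and
the nontrivial ones among \<open>a 0, \<dots>, a m\<close> are kept outside the respective neighbourhoods.\<close>

theorem topologizable_iff_one_not_Zariski_open:
  assumes "countable (carrier G)"
  shows "topologizable G \<longleftrightarrow> one_not_Zariski_open G"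
proof
  assume G: "one_not_Zariski_open G"
  define a where "a = from_nat_into (carrier G)"
  have range_a: "range a = carrier G"
    unfolding a_def using assms by (intro range_from_nat_into) auto
  then have a: "range a \<subseteq> carrier G" by simp
  obtain h where h: "range h \<subseteq> carrier G" "\<And>i. h i \<noteq> \<one>"
    "\<And>n d. a n \<noteq> \<one> \<Longrightarrow> a n \<notin> approx_nbhd a h d n"
    using avoiding_sequence[OF G a] by blast
  define U where "U n = (\<Union>d. approx_nbhd a h d n)" for n
  have U_carrier: "U n \<subseteq> carrier G" for n
    using approx_nbhd_closed[OF a h(1)] by (auto simp: U_def)
  have U_step: "b \<otimes> (x \<otimes> inv y) \<otimes> inv b \<in> U n"
    if b: "b = \<one> \<or> b \<in> a ` {..n}" and x: "x \<in> U (Suc n)" and y: "y \<in> U (Suc n)" for b x y n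
  proof -
    obtain d e where "x \<in> approx_nbhd a h d (Suc n)" "y \<in> approx_nbhd a h e (Suc n)"
      using x y by (auto simp: U_def)
    then have "x \<in> approx_nbhd a h (max d e) (Suc n)" "y \<in> approx_nbhd a h (max d e) (Suc n)"
      by (auto intro: approx_nbhd_mono[THEN subsetD, rotated])
    from approx_nbhd_step[OF b this] show ?thesis unfolding U_def by blast
  qed
  have one_U: "\<one> \<in> U n" for n using one_approx_nbhd by (auto simp: U_def)
  have U_div: "x \<otimes> inv y \<in> U n" if "x \<in> U (Suc n)" "y \<in> U (Suc n)" for x y n
  proof -
    have "x \<in> carrier G" "y \<in> carrier G" using that U_carrier by blast+
    with U_step[of \<one> n x y] that show ?thesis by simp
  qed
  have U_Suc: "U (Suc n) \<subseteq> U n" for n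
  proof
    fix x assume x: "x \<in> U (Suc n)"
    then have "x \<in> carrier G" using U_carrier by blast
    with U_div[OF x one_U] show "x \<in> U n" by simp
  qed
  interpret neighbourhood_sequence G U
  proof
    show "U n \<subseteq> carrier G" "\<one> \<in> U n" "U (Suc n) \<subseteq> U n" for n
      by (rule U_carrier one_U U_Suc)+
    show "x \<otimes> inv y \<in> U n" if "x \<in> U (Suc n)" "y \<in> U (Suc n)" for x y n
      by (rule U_div[OF that])
    fix c n assume "c \<in> carrier G"
    then obtain i where i: "c = a i" using range_a by auto
    \<comment> \<open>Conjugation by \<open>a i\<close> is only provided for at levels from \<open>i\<close> on.\<close>
    have "c \<otimes> x \<otimes> inv c \<in> U n" if x: "x \<in> U (Suc (max n i))" for x
    proof -
      have "c \<otimes> (x \<otimes> inv \<one>) \<otimes> inv c \<in> U (max n i)"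
        by (rule U_step[OF _ x one_U]) (auto simp: i)
      moreover have "x \<in> carrier G" using x U_carrier by blast
      moreover have "U (max n i) \<subseteq> U n" by (rule lift_Suc_antimono_le[of U]) (simp_all add: U_Suc)
      ultimately show ?thesis by auto
    qed
    then show "\<exists>m. \<forall>x\<in>U m. c \<otimes> x \<otimes> inv c \<in> U n" by blast
  qed
  show "topologizable G"
  proof (rule topologizable_if_separating)
    fix x assume "x \<in> carrier G" "x \<noteq> \<one>"
    then have "x \<in> range a" using range_a by simp
    then obtain n where "x = a n" by blast
    with \<open>x \<noteq> \<one>\<close> show "\<exists>n. x \<notin> U n" using h(3)[of n] by (auto simp: U_def)
  next
    fix n
    have "h n \<in> approx_nbhd a h 1 n" by simp
    then have "h n \<in> U n" unfolding U_def by blast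
    with h(2)[of n] show "U n \<noteq> {\<one>}" by auto
  qed
qed (rule one_not_Zariski_open_if_topologizable)

end

text \<open>Words over the image lift to words over \<open>G\<close>, so the condition on \<open>H\<close> can be expressed with a supply of
words and of points that does not depend on \<open>h\<close>.\<close>

lemma (in group_hom) one_not_Zariski_open_image_iff:
  assumes surj: "h ` carrier G = carrier H"
  shows "one_not_Zariski_open H \<longleftrightarrow>
    (\<forall>T\<in>{T. finite T \<and> T \<subseteq> {t. set_gword t \<subseteq> carrier G}}.
       (\<exists>t\<in>T. h (subst G \<one> t) = \<one>\<^bsub>H\<^esub>) \<or>
       (\<exists>w\<in>carrier G. h w \<noteq> \<one>\<^bsub>H\<^esub> \<and> (\<forall>t\<in>T. h (subst G w t) \<noteq> \<one>\<^bsub>H\<^esub>)))"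
    (is "_ \<longleftrightarrow> (\<forall>T\<in>?W. ?trivial T \<or> ?point T)")
proof
  assume Z: "one_not_Zariski_open H"
  show "\<forall>T\<in>?W. ?trivial T \<or> ?point T"
  proof (intro ballI)
    fix T assume "T \<in> ?W"
    then have T: "finite T" "\<And>t. t \<in> T \<Longrightarrow> set_gword t \<subseteq> carrier G" by auto
    have "?point T" if neq: "\<not> ?trivial T"
    proof -
      have "finite (map_gword h ` T)" using T(1) by simp
      moreover have "set_gword t \<subseteq> carrier H \<and> subst H \<one>\<^bsub>H\<^esub> t \<noteq> \<one>\<^bsub>H\<^esub>"
        if t: "t \<in> map_gword h ` T" for t
      proof -
        obtain s where s: "s \<in> T" "t = map_gword h s" using t by blast
        have "subst H (h \<one>) t = h (subst G \<one> s)"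
          unfolding s(2) by (rule subst_hom[OF T(2)[OF s(1)] G.one_closed])
        then have "subst H \<one>\<^bsub>H\<^esub> t = h (subst G \<one> s)" by simp
        moreover have "set_gword t \<subseteq> carrier H"
          using T(2)[OF s(1)] hom_closed by (auto simp: s(2) gword.set_map)
        moreover have "h (subst G \<one> s) \<noteq> \<one>\<^bsub>H\<^esub>" using neq s(1) by blast
        ultimately show ?thesis by metis
      qed
      ultimately obtain g where g: "g \<in> carrier H" "g \<noteq> \<one>\<^bsub>H\<^esub>"
        "\<And>t. t \<in> map_gword h ` T \<Longrightarrow> subst H g t \<noteq> \<one>\<^bsub>H\<^esub>"
        using Z unfolding one_not_Zariski_open_def by meson
      from g(1) obtain w where w: "w \<in> carrier G" "g = h w" unfolding surj[symmetric] by blast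
      have "h (subst G w t) \<noteq> \<one>\<^bsub>H\<^esub>" if "t \<in> T" for t
        using g(3)[OF imageI[OF that]] subst_hom[OF T(2)[OF that] w(1)] w(2) by simp
      with w g(2) show ?thesis by blast
    qed
    then show "?trivial T \<or> ?point T" by blast
  qed
next
  assume R: "\<forall>T\<in>?W. ?trivial T \<or> ?point T"
  show "one_not_Zariski_open H"
    unfolding one_not_Zariski_open_def
  proof (intro allI impI, elim conjE)
    fix S assume "finite S"
      and S: "\<forall>t\<in>S. set_gword t \<subseteq> carrier H \<and> subst H \<one>\<^bsub>H\<^esub> t \<noteq> \<one>\<^bsub>H\<^esub>"
    define r where "r = inv_into (carrier G) h"
    have r: "r g \<in> carrier G" "h (r g) = g" if "g \<in> carrier H" for g
      using that unfolding surj[symmetric] r_def by (auto intro: inv_into_into f_inv_into_f)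
    have lift: "set_gword (map_gword r t) \<subseteq> carrier G" "map_gword h (map_gword r t) = t"
      if "t \<in> S" for t
    proof -
      have t: "set_gword t \<subseteq> carrier H" using S that by blast
      then show "set_gword (map_gword r t) \<subseteq> carrier G" using r(1) by (auto simp: gword.set_map)
      have "map_gword (h \<circ> r) t = map_gword id t"
        using t r(2) by (intro gword.map_cong0) auto
      then show "map_gword h (map_gword r t) = t" by (simp add: gword.map_comp gword.map_id)
    qed
    have eq: "h (subst G w (map_gword r t)) = subst H (h w) t" if "t \<in> S" "w \<in> carrier G" for t w
      using subst_hom[OF lift(1)[OF that(1)] that(2)] lift(2)[OF that(1)] by simp
    have "map_gword r ` S \<in> ?W" using \<open>finite S\<close> lift(1) by blast
    then have "?trivial (map_gword r ` S) \<or> ?point (map_gword r ` S)" using R by blast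
    moreover have "\<not> ?trivial (map_gword r ` S)" using S eq[OF _ G.one_closed] by simp
    ultimately obtain w where "w \<in> carrier G" "h w \<noteq> \<one>\<^bsub>H\<^esub>"
      "\<forall>t\<in>S. h (subst G w (map_gword r t)) \<noteq> \<one>\<^bsub>H\<^esub>"
      by blast
    then show "\<exists>g\<in>carrier H. g \<noteq> \<one>\<^bsub>H\<^esub> \<and> (\<forall>t\<in>S. subst H g t \<noteq> \<one>\<^bsub>H\<^esub>)"
      by (intro bexI[of _ "h w"]) (auto simp: eq)
  qed
qed

section \<open>Tarski monsters of finite exponent\<close>

definition conjugates :: "('a, 'b) monoid_scheme \<Rightarrow> 'a \<Rightarrow> 'a set" where
  "conjugates G x = (\<lambda>g. g \<otimes>\<^bsub>G\<^esub> x \<otimes>\<^bsub>G\<^esub> inv\<^bsub>G\<^esub> g) ` carrier G"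

context group
begin

lemma cyclic_subgroup_iff:
  assumes "subgroup H G"
  shows "cyclic_group (G\<lparr>carrier := H\<rparr>) \<longleftrightarrow> (\<exists>x\<in>H. H = generate G {x})"
proof -
  interpret H: group "G\<lparr>carrier := H\<rparr>"
    using assms subgroup.subgroup_is_group is_group by blast
  have "x [^]\<^bsub>G\<lparr>carrier := H\<rparr>\<^esub> i = x [^] i" if "x \<in> H" for x and i :: int
    using int_pow_consistent[OF assms that] by simp
  moreover have "generate G {x} = range (\<lambda>i :: int. x [^] i)" if "x \<in> H" for x
    using that subgroup.mem_carrier[OF assms] by (auto simp: generate_pow)
  ultimately show ?thesis
    unfolding H.cyclic_group by simp
qed

lemma ord_of_finite_exponent:
  assumes "0 < n" "x \<in> carrier G" "x [^] n = \<one>"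
  shows "0 < ord x" "ord x \<le> n" "finite (generate G {x})" "card (generate G {x}) = ord x"
proof -
  have "ord x dvd n" using assms pow_eq_id by blast
  then show pos: "0 < ord x" and "ord x \<le> n"
    using assms(1) by (auto intro: dvd_imp_le dvd_pos_nat)
  show card: "card (generate G {x}) = ord x" using generate_pow_card[OF assms(2)] by simp
  show "finite (generate G {x})" by (rule card_ge_0_finite) (simp add: card pos)
qed

text \<open>An element \<open>h\<close> of maximal order generates: for every \<open>x\<close>, a common generator \<open>z\<close> of \<open>h\<close> and \<open>x\<close>
cannot have larger order than \<open>h\<close>, so \<open>h\<close> and \<open>z\<close> generate the same subgroup.\<close>

lemma locally_cyclic_imp_cyclic:
  fixes n :: nat
  assumes H: "subgroup H G" and n: "0 < n" "\<And>x. x \<in> H \<Longrightarrow> x [^] n = \<one>"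
    and loc: "\<And>x y. x \<in> H \<Longrightarrow> y \<in> H \<Longrightarrow> \<exists>z\<in>H. x \<in> generate G {z} \<and> y \<in> generate G {z}"
  obtains h where "h \<in> H" "H = generate G {h}" "finite H"
proof -
  have carr: "x \<in> carrier G" if "x \<in> H" for x using that subgroup.mem_carrier[OF H] by blast
  have ord: "ord x \<le> n" "finite (generate G {x})" "card (generate G {x}) = ord x" if "x \<in> H" for x
    using ord_of_finite_exponent[OF n(1) carr[OF that] n(2)[OF that]] by simp_all
  obtain h where h: "h \<in> H" and max: "\<And>x. x \<in> H \<Longrightarrow> ord x \<le> ord h"
  proof -
    have "\<forall>x. x \<in> H \<longrightarrow> ord x < Suc n" using ord(1) le_imp_less_Suc by blast
    from ex_has_greatest_nat[OF subgroup.one_closed[OF H] this] show ?thesis using that by blast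
  qed
  have "x \<in> generate G {h}" if x: "x \<in> H" for x
  proof -
    obtain z where z: "z \<in> H" "h \<in> generate G {z}" "x \<in> generate G {z}"
      using loc[OF h x] by blast
    have "generate G {h} \<subseteq> generate G {z}"
      using z(1,2) carr by (intro generate_subgroup_incl generate_is_subgroup) auto
    moreover have "card (generate G {z}) \<le> card (generate G {h})"
      using max[OF z(1)] ord(3) z(1) h by simp
    ultimately have "generate G {h} = generate G {z}"
      using ord(2)[OF z(1)] by (intro card_seteq)
    with z(3) show ?thesis by simp
  qed
  moreover have "generate G {h} \<subseteq> H" using h by (intro generate_subgroup_incl[OF _ H]) auto
  ultimately have "H = generate G {h}" by blast
  with ord(2)[OF h] h show ?thesis using that by simp
qed

lemma conjugates_closed: "x \<in> carrier G \<Longrightarrow> conjugates G x \<subseteq> carrier G"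
  by (auto simp: conjugates_def)

lemma mem_conjugates_self: "x \<in> carrier G \<Longrightarrow> x \<in> conjugates G x"
  unfolding conjugates_def by (rule image_eqI[of _ _ \<one>]) auto

lemma normal_generate_conjugates:
  assumes x: "x \<in> carrier G"
  shows "generate G (conjugates G x) \<lhd> G"
proof (rule normal_generateI[OF conjugates_closed[OF x]])
  fix c g assume "c \<in> conjugates G x" and g: "g \<in> carrier G"
  then obtain f where f: "f \<in> carrier G" "c = f \<otimes> x \<otimes> inv f" by (auto simp: conjugates_def)
  then have "g \<otimes> c \<otimes> inv g = (g \<otimes> f) \<otimes> x \<otimes> inv (g \<otimes> f)"
    using x g by (simp add: m_assoc inv_mult_group)
  then show "g \<otimes> c \<otimes> inv g \<in> conjugates G x" using f g by (auto simp: conjugates_def)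
qed

lemma generate_conjugates_subset_normal:
  assumes N: "N \<lhd> G" and x: "x \<in> N"
  shows "generate G (conjugates G x) \<subseteq> N"
  by (rule generate_subgroup_incl[OF _ normal_imp_subgroup[OF N]])
     (use x normal.inv_op_closed2[OF N] in \<open>auto simp: conjugates_def\<close>)

text \<open>Quantifying over elements instead of normal subgroups: the normal closure of every nontrivial
element is the whole group.\<close>

lemma simple_iff:
  "simple G \<longleftrightarrow> carrier G \<noteq> {\<one>} \<and>
     (\<forall>x\<in>carrier G. \<forall>y\<in>carrier G. x = \<one> \<or> y \<in> generate G (conjugates G x))"
proof
  assume G: "simple G"
  show "carrier G \<noteq> {\<one>} \<and>
     (\<forall>x\<in>carrier G. \<forall>y\<in>carrier G. x = \<one> \<or> y \<in> generate G (conjugates G x))"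
  proof (intro conjI ballI)
    show "carrier G \<noteq> {\<one>}" using G by (simp add: simple_def)
    fix x y assume x: "x \<in> carrier G" and y: "y \<in> carrier G"
    have "x \<in> generate G (conjugates G x)" by (rule generate.incl[OF mem_conjugates_self[OF x]])
    moreover have "generate G (conjugates G x) = carrier G \<or> generate G (conjugates G x) = {\<one>}"
      using G normal_generate_conjugates[OF x] by (simp add: simple_def)
    ultimately show "x = \<one> \<or> y \<in> generate G (conjugates G x)" using y by auto
  qed
next
  assume R: "carrier G \<noteq> {\<one>} \<and>
     (\<forall>x\<in>carrier G. \<forall>y\<in>carrier G. x = \<one> \<or> y \<in> generate G (conjugates G x))"
  have "N = carrier G \<or> N = {\<one>}" if N: "N \<lhd> G" for N
  proof (rule disjCI)
    assume "N \<noteq> {\<one>}"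
    have sub: "subgroup N G" by (rule normal_imp_subgroup[OF N])
    then obtain x where x: "x \<in> N" "x \<noteq> \<one>"
      using \<open>N \<noteq> {\<one>}\<close> subgroup.one_closed by fastforce
    have "x \<in> carrier G" using x(1) subgroup.mem_carrier[OF sub] by blast
    with R x(2) have "carrier G \<subseteq> generate G (conjugates G x)" by blast
    with generate_conjugates_subset_normal[OF N x(1)] subgroup.subset[OF sub]
    show "N = carrier G" by blast
  qed
  with R show "simple G" by (simp add: simple_def is_group)
qed

text \<open>The condition on all subgroups reduces to subgroups generated by two elements. Of the two
alternatives, being cyclic is witnessed by a generator \<open>z\<close>, and being the whole group by expressions
for the generators of the group; both are finite pieces of information about \<open>G\<close>.\<close>

lemma proper_subgroups_cyclic_iff:
  assumes n: "0 < n" "finite_exponent n G" and S: "S \<subseteq> carrier G" "generate G S = carrier G"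
  shows "(\<forall>H. subgroup H G \<and> H \<noteq> carrier G \<longrightarrow> finite H \<and> cyclic_group (G\<lparr>carrier := H\<rparr>)) \<longleftrightarrow>
    (\<forall>x\<in>carrier G. \<forall>y\<in>carrier G.
       (\<exists>z\<in>generate G {x, y}. x \<in> generate G {z} \<and> y \<in> generate G {z}) \<or>
       (\<forall>s\<in>S. s \<in> generate G {x, y}))"
    (is "?proper \<longleftrightarrow> ?pairs")
proof
  assume proper: ?proper
  show ?pairs
  proof (intro ballI)
    fix x y assume xy: "x \<in> carrier G" "y \<in> carrier G"
    then have sub: "subgroup (generate G {x, y}) G" by (intro generate_is_subgroup) auto
    show "(\<exists>z\<in>generate G {x, y}. x \<in> generate G {z} \<and> y \<in> generate G {z}) \<or>
       (\<forall>s\<in>S. s \<in> generate G {x, y})"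
    proof (cases "generate G {x, y} = carrier G")
      case True
      then show ?thesis using S(1) by blast
    next
      case False
      with sub proper obtain z where "z \<in> generate G {x, y}" "generate G {x, y} = generate G {z}"
        using cyclic_subgroup_iff[OF sub] by blast
      moreover have "x \<in> generate G {x, y}" "y \<in> generate G {x, y}" by (auto intro: generate.incl)
      ultimately show ?thesis by blast
    qed
  qed
next
  assume pairs: ?pairs
  show ?proper
  proof (intro allI impI, elim conjE)
    fix H assume H: "subgroup H G" and "H \<noteq> carrier G"
    have carr: "x \<in> carrier G" if "x \<in> H" for x using that subgroup.mem_carrier[OF H] by blast
    have "\<exists>z\<in>H. x \<in> generate G {z} \<and> y \<in> generate G {z}" if xy: "x \<in> H" "y \<in> H" for x y
    proof -
      have sub: "generate G {x, y} \<subseteq> H" using xy by (intro generate_subgroup_incl[OF _ H]) auto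
      have "\<not> S \<subseteq> H"
        using generate_subgroup_incl[OF _ H, of S] S(2) \<open>H \<noteq> carrier G\<close> carr by auto
      with sub have "\<not> (\<forall>s\<in>S. s \<in> generate G {x, y})" by blast
      with pairs carr xy sub show ?thesis by blast
    qed
    moreover have "x [^] n = \<one>" if "x \<in> H" for x
      using n(2) carr[OF that] by (simp add: finite_exponent_def)
    ultimately obtain h where "h \<in> H" "H = generate G {h}" "finite H"
      using locally_cyclic_imp_cyclic[OF H n(1)] by metis
    then show "finite H \<and> cyclic_group (G\<lparr>carrier := H\<rparr>)"
      using cyclic_subgroup_iff[OF H] by blast
  qed
qed

end

text \<open>A finite set of images is the image of a finite set of representatives, so infinitude becomes a
condition on the finite subsets of \<open>A\<close>.\<close>

lemma infinite_image_iff: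
  "infinite (f ` A) \<longleftrightarrow> (\<forall>S\<in>{S. finite S \<and> S \<subseteq> A}. \<exists>x\<in>A. \<forall>s\<in>S. f x \<noteq> f s)"
proof
  assume inf: "infinite (f ` A)"
  show "\<forall>S\<in>{S. finite S \<and> S \<subseteq> A}. \<exists>x\<in>A. \<forall>s\<in>S. f x \<noteq> f s"
  proof (rule ballI, rule ccontr)
    fix S assume "S \<in> {S. finite S \<and> S \<subseteq> A}" "\<not> (\<exists>x\<in>A. \<forall>s\<in>S. f x \<noteq> f s)"
    then have "finite (f ` S)" "f ` A \<subseteq> f ` S" by auto
    with inf show False using finite_subset by blast
  qed
next
  assume R: "\<forall>S\<in>{S. finite S \<and> S \<subseteq> A}. \<exists>x\<in>A. \<forall>s\<in>S. f x \<noteq> f s"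
  show "infinite (f ` A)"
  proof
    assume "finite (f ` A)"
    then obtain S where S: "S \<subseteq> A" "finite S" "f ` A = f ` S"
      using finite_subset_image[of "f ` A" f A] by blast
    with R obtain x where "x \<in> A" "\<forall>s\<in>S. f x \<noteq> f s" by blast
    with S(3) show False by (metis imageE imageI)
  qed
qed

lemma (in group_hom) img_conjugates:
  assumes "h ` carrier G = carrier H" "x \<in> carrier G"
  shows "conjugates H (h x) = h ` conjugates G x"
  unfolding conjugates_def assms(1)[symmetric] image_image
  using assms(2) by (intro image_cong) auto

text \<open>All quantifiers range over the domain \<open>G\<close> of \<open>h\<close>, which makes the condition a countable
intersection of open ones when \<open>G\<close> is a fixed countable group and the kernel of \<open>h\<close> varies.\<close>

lemma (in group_hom) Tarski_monster_image_iff: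
  assumes surj: "h ` carrier G = carrier H"
    and S: "finite S" "S \<subseteq> carrier G" "generate G S = carrier G" and n: "0 < n"
  shows "Tarski_monster H \<and> finite_exponent n H \<longleftrightarrow>
    (\<forall>w\<in>carrier G. h (w [^] n) = \<one>\<^bsub>H\<^esub>) \<and>
    (\<forall>T\<in>{T. finite T \<and> T \<subseteq> carrier G}. \<exists>w\<in>carrier G. \<forall>t\<in>T. h w \<noteq> h t) \<and>
    (\<forall>x\<in>carrier G. \<forall>y\<in>carrier G.
       h x = \<one>\<^bsub>H\<^esub> \<or> h y \<in> generate H (h ` conjugates G x)) \<and>
    (\<forall>x\<in>carrier G. \<forall>y\<in>carrier G.
       (\<exists>z\<in>generate G {x, y}. h x \<in> generate H (h ` {z}) \<and> h y \<in> generate H (h ` {z})) \<or>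
       (\<forall>s\<in>S. h s \<in> generate H (h ` {x, y})))"
    (is "_ \<longleftrightarrow> ?exponent \<and> ?infinite \<and> ?simple \<and> ?pairs")
proof -
  have hS: "h ` S \<subseteq> carrier H" "generate H (h ` S) = carrier H"
    using S(2,3) generate_img[OF S(2)] surj by auto
  then have fg: "finitely_generated_group H"
    unfolding finitely_generated_group_def using H.is_group S(1) by blast
  have exponent: "finite_exponent n H \<longleftrightarrow> ?exponent"
    unfolding finite_exponent_def surj[symmetric] using n by (simp add: hom_nat_pow)
  have infinite: "infinite (carrier H) \<longleftrightarrow> ?infinite"
    unfolding surj[symmetric] by (rule infinite_image_iff)
  have "?simple \<longleftrightarrow> (\<forall>x\<in>carrier G. \<forall>y\<in>carrier G. h x = \<one>\<^bsub>H\<^esub> \<or>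
      h y \<in> generate H (conjugates H (h x)))"
    by (intro ball_cong refl) (simp only: img_conjugates[OF surj])
  also have "\<dots> \<longleftrightarrow> (\<forall>x\<in>carrier H. \<forall>y\<in>carrier H. x = \<one>\<^bsub>H\<^esub> \<or> y \<in> generate H (conjugates H x))"
    unfolding surj[symmetric] by blast
  finally have simple: "simple H \<longleftrightarrow> ?simple" if "infinite (carrier H)"
    using that by (auto simp: H.simple_iff)
  have gen: "generate H {h x, h y} = h ` generate G {x, y}"
    if "x \<in> carrier G" "y \<in> carrier G" for x y
    using generate_img[of "{x, y}"] that by simp
  have "?pairs \<longleftrightarrow> (\<forall>x\<in>carrier G. \<forall>y\<in>carrier G.
      (\<exists>z\<in>generate H {h x, h y}. h x \<in> generate H {z} \<and> h y \<in> generate H {z}) \<or>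
      (\<forall>s\<in>h ` S. s \<in> generate H {h x, h y}))"
    by (intro ball_cong refl) (simp add: gen)
  also have "\<dots> \<longleftrightarrow> (\<forall>x\<in>carrier H. \<forall>y\<in>carrier H.
      (\<exists>z\<in>generate H {x, y}. x \<in> generate H {z} \<and> y \<in> generate H {z}) \<or>
      (\<forall>s\<in>h ` S. s \<in> generate H {x, y}))"
    unfolding surj[symmetric] by blast
  finally have "(\<forall>K. subgroup K H \<and> K \<noteq> carrier H \<longrightarrow>
      finite K \<and> cyclic_group (H\<lparr>carrier := K\<rparr>)) \<longleftrightarrow> ?pairs" if "finite_exponent n H"
    using H.proper_subgroups_cyclic_iff[OF n that hS] by simp
  then show ?thesis
    unfolding Tarski_monster_def using fg exponent infinite simple by blast
qed

section \<open>Open conditions on marked groups\<close>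

lemma gdelta_in_Ball:
  assumes "countable I" "\<And>i. i \<in> I \<Longrightarrow> gdelta_in X {x \<in> topspace X. P i x}"
  shows "gdelta_in X {x \<in> topspace X. \<forall>i\<in>I. P i x}"
proof (cases "I = {}")
  case False
  have "gdelta_in X (\<Inter>i\<in>I. {x \<in> topspace X. P i x})"
    using assms False by (intro gdelta_in_Inter) auto
  moreover have "(\<Inter>i\<in>I. {x \<in> topspace X. P i x}) = {x \<in> topspace X. \<forall>i\<in>I. P i x}"
    using False by auto
  ultimately show ?thesis by simp
qed simp

lemma gdelta_in_Collect_conj:
  assumes "gdelta_in X {x \<in> topspace X. P x}" "gdelta_in X {x \<in> topspace X. Q x}"
  shows "gdelta_in X {x \<in> topspace X. P x \<and> Q x}"
  using gdelta_in_Int[OF assms] by (simp add: Collect_conj_eq Int_ac)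

lemma openin_Collect_conj:
  assumes "openin X {x \<in> topspace X. P x}" "openin X {x \<in> topspace X. Q x}"
  shows "openin X {x \<in> topspace X. P x \<and> Q x}"
  using openin_Int[OF assms] by (simp add: Collect_conj_eq Int_ac)

lemma openin_Collect_disj:
  assumes "openin X {x \<in> topspace X. P x}" "openin X {x \<in> topspace X. Q x}"
  shows "openin X {x \<in> topspace X. P x \<or> Q x}"
  using openin_Un[OF assms] by (simp add: Collect_disj_eq Int_Un_distrib Collect_conj_eq)

lemma openin_Collect_Bex:
  assumes "\<And>i. i \<in> I \<Longrightarrow> openin X {x \<in> topspace X. P i x}"
  shows "openin X {x \<in> topspace X. \<exists>i\<in>I. P i x}"
proof -
  have "openin X (\<Union>i\<in>I. {x \<in> topspace X. P i x})" using assms by auto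
  moreover have "(\<Union>i\<in>I. {x \<in> topspace X. P i x}) = {x \<in> topspace X. \<exists>i\<in>I. P i x}" by auto
  ultimately show ?thesis by simp
qed

lemma openin_Collect_Ball:
  assumes "finite I" "\<And>i. i \<in> I \<Longrightarrow> openin X {x \<in> topspace X. P i x}"
  shows "openin X {x \<in> topspace X. \<forall>i\<in>I. P i x}"
  using assms by (induction I) (auto intro: openin_Collect_conj)

text \<open>The \<open>+ 1\<close> keeps the radius positive for the empty word, which lies in every normal subgroup; for
all other words the radius is smaller than \<open>1 / |w|\<close>.\<close>

lemma marked_dist_mem_iff:
  assumes "M \<in> marked_groups k" "N \<in> marked_groups k" "marked_dist M N < 1 / (real (length w) + 1)"
  shows "w \<in> M \<longleftrightarrow> w \<in> N"
proof (rule ccontr)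
  assume "\<not> ?thesis"
  then have w: "w \<in> sym_diff M N" by auto
  have "[] \<in> L" if "L \<in> marked_groups k" for L
    using that subgroup.one_closed[OF normal_imp_subgroup, of L "F k"]
    by (simp add: marked_groups_def free_group_def)
  then have "w \<noteq> []" using w assms(1,2) by auto
  have "1 / (real (length w) + 1) \<le> 1 / real (length w)"
    using \<open>w \<noteq> []\<close> by (intro divide_left_mono) auto
  also have "\<dots> \<le> marked_dist M N" using marked_dist_max(2)[of M N w] w by auto
  finally show False using assms(3) by simp
qed

text \<open>Membership of a fixed word is a clopen condition; \<open>b\<close> covers both it and its negation.\<close>

lemma openin_marked_space_mem:
  "openin (marked_space k) {N \<in> marked_groups k. (w \<in> N) = b}"
proof -
  interpret Metric_space "marked_groups k" marked_dist by (rule Metric_space_marked_groups)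
  show ?thesis
    unfolding marked_space_def openin_mtopology
  proof (intro conjI allI impI)
    fix N assume N: "N \<in> {N \<in> marked_groups k. (w \<in> N) = b}"
    show "\<exists>r>0. mball N r \<subseteq> {N \<in> marked_groups k. (w \<in> N) = b}"
    proof (intro exI[of _ "1 / (real (length w) + 1)"] conjI subsetI)
      fix M assume "M \<in> mball N (1 / (real (length w) + 1))"
      then show "M \<in> {N \<in> marked_groups k. (w \<in> N) = b}"
        using N marked_dist_mem_iff[of N k M w] by auto
    qed simp
  qed auto
qed

lemma countable_words: "countable (A :: nat word set)"
  by (rule countableI_type)

lemma letters_closed: "(\<lambda>i. [(False, i)]) ` {1..k} \<subseteq> carrier (F k)"
  by (auto simp: free_group_def)

lemma generate_letters: "generate (F k) ((\<lambda>i. [(False, i)]) ` {1..k}) = carrier (F k)"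
proof -
  interpret group "F k" by (rule group_free_group)
  let ?S = "(\<lambda>i. [(False, i)]) ` {1..k}"
  note S = letters_closed[of k]
  have letter: "[a] \<in> generate (F k) ?S" if a: "snd a \<in> {1..k}" for a
  proof (cases "fst a")
    case False
    then have "[a] = [(False, snd a)]" by (cases a) simp
    then show ?thesis using a by (auto intro!: generate.incl)
  next
    case True
    have x: "[(False, snd a)] \<in> ?S" using a by blast
    have "[a] \<otimes>\<^bsub>F k\<^esub> [(False, snd a)] = \<one>\<^bsub>F k\<^esub>"
      using True by (cases a) (simp add: free_group_def letter_inv_def)
    moreover have "[a] \<in> carrier (F k)" using a by (simp add: free_group_def)
    ultimately have "[a] = inv\<^bsub>F k\<^esub> [(False, snd a)]"
      using x S inv_equality[of "[a]" "[(False, snd a)]"] by (simp add: subset_iff)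
    then show ?thesis using generate.inv[OF x, of "F k"] by simp
  qed
  have "w \<in> generate (F k) ?S" if "w \<in> carrier (F k)" for w
    using that
  proof (induction w)
    case Nil
    then show ?case using generate.one[of "F k" ?S] by (simp add: free_group_def)
  next
    case (Cons a w)
    then have "w \<in> carrier (F k)" "snd a \<in> {1..k}"
      by (auto simp: free_group_def dest: reduced_ConsD)
    with Cons.IH letter have "[a] \<otimes>\<^bsub>F k\<^esub> w \<in> generate (F k) ?S" by (blast intro: generate.eng)
    moreover have "[a] \<otimes>\<^bsub>F k\<^esub> w = a # w"
      using Cons.prems by (simp add: free_group_def cons_reduce_Cons)
    ultimately show ?case by simp
  qed
  then show ?thesis using generate_in_carrier[OF S] by blast
qed

lemma (in normal) rcos_eq_iff:
  assumes "x \<in> carrier G" "y \<in> carrier G"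
  shows "H #> x = H #> y \<longleftrightarrow> x \<otimes> inv y \<in> H"
proof
  assume "H #> x = H #> y"
  then have "x \<in> H #> y" using rcos_self[OF assms(1) subgroup_axioms] by simp
  then show "x \<otimes> inv y \<in> H" using rcos_module_imp[OF is_group assms(2)] by simp
next
  assume "x \<otimes> inv y \<in> H"
  then have "x \<in> H #> y" using rcos_module_rev[OF is_group assms(2,1)] by simp
  then show "H #> x = H #> y" using repr_independence[OF _ assms(2) subgroup_axioms] by simp
qed

lemma openin_coset_eq:
  assumes "u \<in> carrier (F k)" "v \<in> carrier (F k)"
  shows "openin (marked_space k) {N \<in> marked_groups k. N #>\<^bsub>F k\<^esub> u = N #>\<^bsub>F k\<^esub> v}"
    and "openin (marked_space k) {N \<in> marked_groups k. N #>\<^bsub>F k\<^esub> u \<noteq> N #>\<^bsub>F k\<^esub> v}"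
proof -
  have "{N \<in> marked_groups k. (N #>\<^bsub>F k\<^esub> u = N #>\<^bsub>F k\<^esub> v) = b} =
      {N \<in> marked_groups k. (u \<otimes>\<^bsub>F k\<^esub> inv\<^bsub>F k\<^esub> v \<in> N) = b}" for b
    using normal.rcos_eq_iff[OF _ assms] by (auto simp: marked_groups_def)
  then have "openin (marked_space k) {N \<in> marked_groups k. (N #>\<^bsub>F k\<^esub> u = N #>\<^bsub>F k\<^esub> v) = b}" for b
    by (simp only: openin_marked_space_mem)
  from this[of True] this[of False]
  show "openin (marked_space k) {N \<in> marked_groups k. N #>\<^bsub>F k\<^esub> u = N #>\<^bsub>F k\<^esub> v}"
    and "openin (marked_space k) {N \<in> marked_groups k. N #>\<^bsub>F k\<^esub> u \<noteq> N #>\<^bsub>F k\<^esub> v}"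
    by simp_all
qed

lemma group_hom_quotient_map:
  assumes "N \<in> marked_groups k"
  shows "group_hom (F k) (F k Mod N) ((#>\<^bsub>F k\<^esub>) N)"
proof -
  interpret normal N "F k" using assms by (simp add: marked_groups_def)
  show ?thesis
    unfolding group_hom_def group_hom_axioms_def
    using group_free_group factorgroup_is_group r_coset_hom_Mod by blast
qed

lemma quotient_map_surj: "(#>\<^bsub>F k\<^esub>) N ` carrier (F k) = carrier (F k Mod N)"
  by (auto simp: FactGroup_def RCOSETS_def)

text \<open>Membership in a generated subgroup of the quotient is witnessed by an element of the subgroup
generated in the free group. Hence the set is a union of clopen sets, one for each witness.\<close>

lemma openin_coset_mem_generate:
  assumes "A \<subseteq> carrier (F k)" "w \<in> carrier (F k)"
  shows "openin (marked_space k)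
    {N \<in> marked_groups k. N #>\<^bsub>F k\<^esub> w \<in> generate (F k Mod N) ((#>\<^bsub>F k\<^esub>) N ` A)}"
proof -
  have "{N \<in> marked_groups k. N #>\<^bsub>F k\<^esub> w \<in> generate (F k Mod N) ((#>\<^bsub>F k\<^esub>) N ` A)} =
      {N \<in> marked_groups k. \<exists>v\<in>generate (F k) A. N #>\<^bsub>F k\<^esub> w = N #>\<^bsub>F k\<^esub> v}"
    using group_hom.generate_img[OF group_hom_quotient_map assms(1)] by (auto simp: image_iff)
  also have "openin (marked_space k) \<dots>"
    using assms group.generate_in_carrier[OF group_free_group assms(1)]
    by (intro openin_Collect_Bex[of _ "marked_space k", unfolded topspace_marked_space] openin_coset_eq)
       auto
  finally show ?thesis .
qed

lemma openin_coset_eq_one: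
  assumes "w \<in> carrier (F k)"
  shows "openin (marked_space k) {N \<in> marked_groups k. N #>\<^bsub>F k\<^esub> w = \<one>\<^bsub>F k Mod N\<^esub>}"
    and "openin (marked_space k) {N \<in> marked_groups k. N #>\<^bsub>F k\<^esub> w \<noteq> \<one>\<^bsub>F k Mod N\<^esub>}"
proof -
  have one: "\<one>\<^bsub>F k\<^esub> \<in> carrier (F k)"
    using group.is_monoid[OF group_free_group] by (rule monoid.one_closed)
  have eq: "N #>\<^bsub>F k\<^esub> \<one>\<^bsub>F k\<^esub> = \<one>\<^bsub>F k Mod N\<^esub>" if "N \<in> marked_groups k" for N
    by (rule group_hom.hom_one[OF group_hom_quotient_map[OF that]])
  show "openin (marked_space k) {N \<in> marked_groups k. N #>\<^bsub>F k\<^esub> w = \<one>\<^bsub>F k Mod N\<^esub>}"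
    using openin_coset_eq(1)[OF assms one] eq by (simp cong: conj_cong)
  show "openin (marked_space k) {N \<in> marked_groups k. N #>\<^bsub>F k\<^esub> w \<noteq> \<one>\<^bsub>F k Mod N\<^esub>}"
    using openin_coset_eq(2)[OF assms one] eq by (simp cong: conj_cong)
qed

lemma topologizable_quotient_iff:
  assumes "N \<in> marked_groups k"
  shows "topologizable (F k Mod N) \<longleftrightarrow>
    (\<forall>T\<in>{T. finite T \<and> T \<subseteq> {t. set_gword t \<subseteq> carrier (F k)}}.
       (\<exists>t\<in>T. N #>\<^bsub>F k\<^esub> subst (F k) \<one>\<^bsub>F k\<^esub> t = \<one>\<^bsub>F k Mod N\<^esub>) \<or>
       (\<exists>w\<in>carrier (F k). N #>\<^bsub>F k\<^esub> w \<noteq> \<one>\<^bsub>F k Mod N\<^esub> \<and>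
          (\<forall>t\<in>T. N #>\<^bsub>F k\<^esub> subst (F k) w t \<noteq> \<one>\<^bsub>F k Mod N\<^esub>)))"
proof -
  interpret q: group_hom "F k" "F k Mod N" "(#>\<^bsub>F k\<^esub>) N"
    by (rule group_hom_quotient_map[OF assms])
  have "countable (carrier (F k Mod N))"
    unfolding quotient_map_surj[symmetric] by (intro countable_image countable_words)
  then show ?thesis
    unfolding q.one_not_Zariski_open_image_iff[OF quotient_map_surj, symmetric]
    by (rule q.H.topologizable_iff_one_not_Zariski_open)
qed

lemmas Tarski_monster_quotient_iff =
  group_hom.Tarski_monster_image_iff[OF group_hom_quotient_map quotient_map_surj
    finite_imageI[OF finite_atLeastAtMost] letters_closed generate_letters]

theorem proposition1p5:
  fixes k :: nat
  shows "gdelta_in (marked_space k) {N \<in> marked_groups k. topologizable (F k Mod N)} \<and>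
    (\<forall>n::nat. 0 < n \<longrightarrow>
      gdelta_in (marked_space k)
        {N \<in> marked_groups k. Tarski_monster (F k Mod N) \<and> finite_exponent n (F k Mod N)})"
proof (intro conjI allI impI)
  interpret group "F k" by (rule group_free_group)
  note gdelta_rules =
    gdelta_in_Ball[of _ "marked_space k", unfolded topspace_marked_space]
    gdelta_in_Collect_conj[of "marked_space k", unfolded topspace_marked_space]
  note open_rules =
    openin_Collect_Bex[of _ "marked_space k", unfolded topspace_marked_space]
    openin_Collect_Ball[of _ "marked_space k", unfolded topspace_marked_space]
    openin_Collect_conj[of "marked_space k", unfolded topspace_marked_space]
    openin_Collect_disj[of "marked_space k", unfolded topspace_marked_space]
    openin_coset_eq openin_coset_eq_one openin_coset_mem_generate
  have words: "countable {T :: nat word gword set. finite T \<and> T \<subseteq> A}" for A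
    by (rule countable_Collect_finite_subset) (rule countableI_type)
  have gen: "z \<in> carrier (F k)"
    if "x \<in> carrier (F k)" "y \<in> carrier (F k)" "z \<in> generate (F k) {x, y}" for x y z
    using that generate_in_carrier[of "{x, y}" z] by simp
  \<comment> \<open>The outer universal quantifiers range over countable sets, of words or of finite sets of words; what they bind is an open condition.\<close>
  show "gdelta_in (marked_space k) {N \<in> marked_groups k. topologizable (F k Mod N)}"
    by (simp only: topologizable_quotient_iff cong: conj_cong,
        intro gdelta_rules words; rule open_imp_gdelta_in; intro open_rules)
       (blast intro: subst_closed one_closed)+
  fix n :: nat assume n: "0 < n"
  show "gdelta_in (marked_space k)
        {N \<in> marked_groups k. Tarski_monster (F k Mod N) \<and> finite_exponent n (F k Mod N)}"
    by (simp only: Tarski_monster_quotient_iff n cong: conj_cong,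
        intro gdelta_rules countable_words countable_Collect_finite_subset;
        rule open_imp_gdelta_in; intro open_rules)
       (simp_all del: One_nat_def, (use letters_closed gen conjugates_closed in blast)+)
qed

end
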